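(* Let $\Omega=[0,1]^2$ be the unit square and let $W_{\mathrm{magic}}^+:\mathrm{GL}^+(2)\to\mathbb{R}$, $W_{\mathrm{magic}}^+(F)=\frac{\lambda_{\max}}{\lambda_{\min}}+2\log\lambda_{\min}$, where $\lambda_{\max}\geq\lambda_{\min}>0$ are the ordered singular values of $F\in\mathrm{GL}^+(2)$. For any homogeneous deformation $\varphi_0(x)=F_0x$ with $F_0=\mathrm{diag}(a_1,a_2)$ and $a_1\geq a_2>0$, the elastic energy $I(\varphi)=\int_\Omega W_{\mathrm{magic}}^+(\nabla\varphi)\,\mathrm{d}x$ is equal to $I(\varphi_0)$ for all periodic deformations $\varphi(x)=F_0x+\vartheta_\#(x)$ with $\vartheta_\#$ of the type $$\vartheta_\#(x_1,x_2)=\begin{pmatrix}f_\#(x_1)\\0\end{pmatrix}\qquad\text{with}\qquad f_\#'(x)\geq a_2-a_1\quad\text{for all }x\in[0,1].$$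
   Context: $\mathrm{GL}^+(2)$ denotes the set of real $2\times2$ matrices with positive determinant. A periodic deformation on $\Omega=[0,1]^2$ is a map $\varphi(x)=F_0x+\vartheta_\#(x)$ with $F_0\in\mathrm{GL}^+(2)$ and a periodic superposition $\vartheta_\#\in W^{1,\infty}_{\mathrm{per}}(\Omega)$, i.e. $\vartheta_\#:\Omega\to\mathbb{R}^2$ is in $W^{1,\infty}$ and satisfies $\vartheta_\#(x,0)=\vartheta_\#(x,1)$ and $\nabla\vartheta_\#(x,0)=\nabla\vartheta_\#(x,1)$ for all $x\in[0,1]$, as well as $\vartheta_\#(0,y)=\vartheta_\#(1,y)$ and $\nabla\vartheta_\#(0,y)=\nabla\vartheta_\#(1,y)$ for all $y\in[0,1]$. For $\vartheta_\#$ of the form $(f_\#(x_1),0)^T$ this means that $f_\#:[0,1]\to\mathbb{R}$ satisfies $f_\#(0)=f_\#(1)$ and $f_\#'(0)=f_\#'(1)$. *)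

theory Defs
  imports "HOL-Analysis.Analysis"
begin

section \<open>Weak derivatives\<close>

text \<open>\<open>C_diff k \<psi>\<close>: all iterated partial derivatives of \<open>\<psi>\<close> up to order \<open>k\<close> exist and are
  continuous.\<close>

primrec C_diff :: "nat \<Rightarrow> ('a::euclidean_space \<Rightarrow> real) \<Rightarrow> bool" where
  "C_diff 0 \<psi> \<longleftrightarrow> continuous_on UNIV \<psi>"
| "C_diff (Suc k) \<psi> \<longleftrightarrow> (\<forall>x. \<psi> differentiable (at x)) \<and>
     (\<forall>b\<in>Basis. C_diff k (\<lambda>x. frechet_derivative \<psi> (at x) b))"

definition test_functions :: "'a::euclidean_space set \<Rightarrow> ('a \<Rightarrow> real) set" where
  "test_functions U = {\<psi>. (\<forall>k. C_diff k \<psi>) \<and>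
     compact (closure {x. \<psi> x \<noteq> 0}) \<and> closure {x. \<psi> x \<noteq> 0} \<subseteq> U}"

definition locally_integrable_on :: "('a::euclidean_space \<Rightarrow> real) \<Rightarrow> 'a set \<Rightarrow> bool"
    (infixr "locally'_integrable'_on" 46) where
  "u locally_integrable_on U \<longleftrightarrow>
     (\<forall>K. compact K \<and> K \<subseteq> U \<longrightarrow> u absolutely_integrable_on K)"

definition weak_partial_deriv ::
    "'a::euclidean_space set \<Rightarrow> 'a \<Rightarrow> ('a \<Rightarrow> real) \<Rightarrow> ('a \<Rightarrow> real) \<Rightarrow> bool" where
  "weak_partial_deriv U b u v \<longleftrightarrow>
     u locally_integrable_on U \<and> v locally_integrable_on U \<and>
     (\<forall>\<psi>\<in>test_functions U.
        (LINT x:U|lebesgue. u x * frechet_derivative \<psi> (at x) b)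
          = - (LINT x:U|lebesgue. v x * \<psi> x))"

definition weak_jacobian ::
    "(real^'n) set \<Rightarrow> (real^'n \<Rightarrow> real^'m) \<Rightarrow> (real^'n \<Rightarrow> real^'n^'m) \<Rightarrow> bool" where
  "weak_jacobian U u G \<longleftrightarrow>
     (\<forall>i j. weak_partial_deriv U (axis j 1) (\<lambda>x. u x $ i) (\<lambda>x. G x $ i $ j))"

text \<open>Only almost everywhere determined.\<close>

definition weak_grad :: "(real^'n) set \<Rightarrow> (real^'n \<Rightarrow> real^'m) \<Rightarrow> real^'n \<Rightarrow> real^'n^'m" where
  "weak_grad U u = (SOME G. weak_jacobian U u G)"

definition L_infinity :: "'a::euclidean_space set \<Rightarrow> ('a \<Rightarrow> 'b::euclidean_space) \<Rightarrow> bool" where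
  "L_infinity U g \<longleftrightarrow> g \<in> borel_measurable (lebesgue_on U) \<and>
     (\<exists>C. AE x in lebesgue_on U. norm (g x) \<le> C)"

definition W1_infinity :: "(real^'n) set \<Rightarrow> (real^'n \<Rightarrow> real^'m) \<Rightarrow> bool" where
  "W1_infinity U u \<longleftrightarrow> L_infinity U u \<and> (\<exists>G. weak_jacobian U u G \<and> L_infinity U G)"

text \<open>Pointwise statements about derivatives of Sobolev functions (boundary values, bounds
  required at every point of a closed set) refer to a representative of the weak derivative which
  takes the value of the classical derivative (one-sided at boundary points) wherever that exists.
  Where the function is not classically differentiable the value of the representative is not
  constrained.\<close>

definition gradient_field ::
    "(real^'n) set \<Rightarrow> (real^'n \<Rightarrow> real^'m) \<Rightarrow> (real^'n \<Rightarrow> real^'n^'m) \<Rightarrow> bool" where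
  "gradient_field S u G \<longleftrightarrow> weak_jacobian (interior S) u G \<and>
     (\<forall>x\<in>S. \<forall>A. (u has_derivative (\<lambda>h. A *v h)) (at x within S) \<longrightarrow> G x = A)"

definition derivative_function ::
    "real set \<Rightarrow> (real \<Rightarrow> real) \<Rightarrow> (real \<Rightarrow> real) \<Rightarrow> bool" where
  "derivative_function S f f' \<longleftrightarrow> weak_partial_deriv (interior S) 1 f f' \<and>
     (\<forall>x\<in>S. \<forall>D. (f has_real_derivative D) (at x within S) \<longrightarrow> f' x = D)"


section \<open>Periodic deformations of the unit square\<close>

definition unit_square :: "(real^2) set" where
  "unit_square = cbox 0 1"

definition GLpos2 :: "(real^2^2) set" where
  "GLpos2 = {F. det F > 0}"

definition diag2 :: "real \<Rightarrow> real \<Rightarrow> real^2^2" where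
  "diag2 a b = vector [vector [a, 0], vector [0, b]]"

definition periodic_on_square :: "(real^2 \<Rightarrow> 'b) \<Rightarrow> bool" where
  "periodic_on_square g \<longleftrightarrow>
     (\<forall>x\<in>{0..1}. g (vector [x, 0]) = g (vector [x, 1])) \<and>
     (\<forall>y\<in>{0..1}. g (vector [0, y]) = g (vector [1, y]))"

text \<open>A \<open>W\<^sup>1\<^sup>,\<^sup>\<infinity>\<close> function on the square is identified with its continuous representative, without
  which the boundary values in the periodicity condition would be meaningless.\<close>

definition periodic_superposition :: "(real^2 \<Rightarrow> real^2) \<Rightarrow> bool" where
  "periodic_superposition \<theta> \<longleftrightarrow>
     W1_infinity (interior unit_square) \<theta> \<and> continuous_on unit_square \<theta> \<and>
     periodic_on_square \<theta> \<and>
     (\<exists>G. gradient_field unit_square \<theta> G \<and> periodic_on_square G)"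

definition periodic_deformation ::
    "real^2^2 \<Rightarrow> (real^2 \<Rightarrow> real^2) \<Rightarrow> (real^2 \<Rightarrow> real^2) \<Rightarrow> bool" where
  "periodic_deformation F\<^sub>0 \<theta> \<phi> \<longleftrightarrow> F\<^sub>0 \<in> GLpos2 \<and> periodic_superposition \<theta> \<and>
     (\<forall>x\<in>unit_square. \<phi> x = F\<^sub>0 *v x + \<theta> x)"


section \<open>The energy\<close>

text \<open>Singular values: square roots of the eigenvalues of \<open>F\<^sup>T F\<close>.\<close>

definition singular_values :: "real^'n^'n \<Rightarrow> real set" where
  "singular_values F =
     {s. s \<ge> 0 \<and> (\<exists>v. v \<noteq> 0 \<and> (transpose F ** F) *v v = s\<^sup>2 *\<^sub>R v)}"

definition lambda_max :: "real^2^2 \<Rightarrow> real" where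
  "lambda_max F = Max (singular_values F)"

definition lambda_min :: "real^2^2 \<Rightarrow> real" where
  "lambda_min F = Min (singular_values F)"

text \<open>Meaningful on \<^const>\<open>GLpos2\<close> only.\<close>

definition W_magic :: "real^2^2 \<Rightarrow> real" where
  "W_magic F = lambda_max F / lambda_min F + 2 * ln (lambda_min F)"

definition energy :: "(real^2 \<Rightarrow> real^2) \<Rightarrow> real" where
  "energy \<phi> = (LINT x:unit_square|lebesgue. W_magic (weak_grad (interior unit_square) \<phi> x))"

text \<open>The Bochner integral of a non-integrable function is \<open>0\<close> and \<^const>\<open>W_magic\<close> is total, so the
  integral defining \<^const>\<open>energy\<close> is a genuine one only under the following condition.\<close>

definition energy_well_defined :: "(real^2 \<Rightarrow> real^2) \<Rightarrow> bool" where
  "energy_well_defined \<phi> \<longleftrightarrow>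
     (\<exists>G. weak_jacobian (interior unit_square) \<phi> G) \<and>
     (AE x in lebesgue_on unit_square. weak_grad (interior unit_square) \<phi> x \<in> GLpos2) \<and>
     (\<lambda>x. W_magic (weak_grad (interior unit_square) \<phi> x)) absolutely_integrable_on unit_square"

end

theory Submission
  imports Defs
begin

text \<open>Write \<open>F\<^sub>0\<close> for the diagonal matrix with entries \<open>a\<^sub>1 \<ge> a\<^sub>2\<close>. The gradient of the deformation
is the diagonal matrix with entries \<open>a\<^sub>1 + f' (x\<^sub>1)\<close> and \<open>a\<^sub>2\<close>. The lower bound on \<open>f'\<close> says
precisely that the first entry stays the larger one, hence the larger singular value. Therefore the energy
density at this gradient is \<open>(a\<^sub>1 + f' (x\<^sub>1)) / a\<^sub>2 + 2 ln a\<^sub>2\<close>, which is affine in \<open>f'\<close>, and the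
integral of \<open>f' (x\<^sub>1)\<close> over the square vanishes because \<open>f\<close> takes the same value at both ends of
the unit interval. What remains is \<open>a\<^sub>1 / a\<^sub>2 + 2 ln a\<^sub>2\<close>, the energy density at \<open>F\<^sub>0\<close>.

The work lies in making this precise for weak derivatives. The energy refers to an arbitrarily chosen
weak gradient, so weak gradients must be unique almost everywhere; this is the
fundamental lemma of the calculus of variations (\<open>fundamental_lemma\<close>), which needs a supply of
test functions. All test functions constructed here are products over the coordinates of smooth
approximations of indicators of intervals (\<open>plateau\<close>). Against such products a function of one
coordinate can be integrated one coordinate at a time (\<open>cylinder_integral\<close>), and this yields the two
facts about functions of one coordinate that carry the proof: their weak gradient is given by the
one-dimensional weak derivative (\<open>weak_partial_deriv_cylinder\<close>), and it has mean zero if the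
boundary values agree (\<open>integral_weak_partial_deriv_eq_0\<close>).

The weak gradient of the superposition on the square is essentially bounded, which makes
the energy density integrable; the lower bound on \<open>f'\<close> carries over to the first entry
of this gradient almost everywhere. Finally the affine part of the deformation has its matrix as a
weak gradient (\<open>weak_jacobian_linear\<close>), by integration by parts in the form of
\<open>integral_directional_derivative_eq_0\<close>.\<close>

section \<open>Smooth functions\<close>

text \<open>Smoothness as required of test functions: no constraint on the support.\<close>

definition smooth :: "('a::euclidean_space \<Rightarrow> real) \<Rightarrow> bool" where
  "smooth \<psi> \<longleftrightarrow> (\<forall>k. C_diff k \<psi>)"

lemma C_diff_Suc_imp: "C_diff (Suc k) \<psi> \<Longrightarrow> C_diff k \<psi>"
proof (induction k arbitrary: \<psi>)
  case 0
  then show ?case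
    by (auto simp: continuous_on_eq_continuous_at intro: differentiable_imp_continuous_within)
next
  case (Suc k)
  then show ?case by (metis C_diff.simps(2))
qed

text \<open>Iterated differentiability is defined through \<^const>\<open>frechet_derivative\<close>, a choice operator.
  This rule lets a concrete derivative be supplied instead.\<close>

lemma C_diff_SucI:
  assumes "\<And>x. (\<psi> has_derivative \<psi>' x) (at x)"
    and "\<And>b. b \<in> Basis \<Longrightarrow> C_diff k (\<lambda>x. \<psi>' x b)"
  shows "C_diff (Suc k) \<psi>"
proof -
  have "frechet_derivative \<psi> (at x) = \<psi>' x" for x
    using assms(1) by (metis frechet_derivative_at)
  then show ?thesis using assms by (auto simp: differentiable_def)
qed

lemma C_diff_has_derivative:
  "C_diff (Suc k) \<psi> \<Longrightarrow> (\<psi> has_derivative frechet_derivative \<psi> (at x)) (at x)"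
  by (simp add: frechet_derivative_works)

lemma C_diff_const: "C_diff k (\<lambda>x::'a::euclidean_space. c)"
proof (induction k arbitrary: c)
  case (Suc k)
  show ?case by (rule C_diff_SucI[where \<psi>' = "\<lambda>_ _. 0"]) (auto intro: Suc)
qed auto

lemma C_diff_add: "C_diff k \<psi> \<Longrightarrow> C_diff k \<eta> \<Longrightarrow> C_diff k (\<lambda>x. \<psi> x + \<eta> x)"
proof (induction k arbitrary: \<psi> \<eta>)
  case (Suc k)
  show ?case
    by (rule C_diff_SucI[where \<psi>' = "\<lambda>x h. frechet_derivative \<psi> (at x) h + frechet_derivative \<eta> (at x) h"])
       (use Suc in \<open>auto intro!: derivative_intros C_diff_has_derivative[of k] simp del: C_diff.simps\<close>, auto)
qed (auto intro: continuous_intros)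

lemma C_diff_mult: "C_diff k \<psi> \<Longrightarrow> C_diff k \<eta> \<Longrightarrow> C_diff k (\<lambda>x. \<psi> x * \<eta> x)"
proof (induction k arbitrary: \<psi> \<eta>)
  case (Suc k)
  show ?case
  proof (rule C_diff_SucI[where
        \<psi>' = "\<lambda>x h. \<psi> x * frechet_derivative \<eta> (at x) h + frechet_derivative \<psi> (at x) h * \<eta> x"])
    show "((\<lambda>x. \<psi> x * \<eta> x) has_derivative
        (\<lambda>h. \<psi> x * frechet_derivative \<eta> (at x) h + frechet_derivative \<psi> (at x) h * \<eta> x)) (at x)" for x
      by (intro has_derivative_mult C_diff_has_derivative[of k] Suc)
    show "C_diff k (\<lambda>x. \<psi> x * frechet_derivative \<eta> (at x) b + frechet_derivative \<psi> (at x) b * \<eta> x)"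
      if "b \<in> Basis" for b
      using Suc.prems that by (intro C_diff_add Suc.IH) (auto intro: C_diff_Suc_imp)
  qed
qed (auto intro: continuous_intros)

lemma smooth_intros:
  shows smooth_const: "smooth (\<lambda>x::'a::euclidean_space. c)"
    and smooth_add: "smooth \<psi> \<Longrightarrow> smooth \<eta> \<Longrightarrow> smooth (\<lambda>x::'a. \<psi> x + \<eta> x)"
    and smooth_mult: "smooth \<psi> \<Longrightarrow> smooth \<eta> \<Longrightarrow> smooth (\<lambda>x::'a. \<psi> x * \<eta> x)"
  by (auto simp: smooth_def C_diff_const C_diff_add C_diff_mult)

lemma smooth_prod:
  "(\<And>i. i \<in> I \<Longrightarrow> smooth (\<psi> i)) \<Longrightarrow> smooth (\<lambda>x. \<Prod>i\<in>I. \<psi> i x)"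
  by (induction I rule: infinite_finite_induct) (auto intro: smooth_intros)

lemma smooth_iff_real:
  fixes \<alpha> \<alpha>' :: "real \<Rightarrow> real"
  assumes "\<And>t. (\<alpha> has_real_derivative \<alpha>' t) (at t)"
  shows "smooth \<alpha> \<longleftrightarrow> smooth \<alpha>'"
proof -
  have "frechet_derivative \<alpha> (at t) = (*) (\<alpha>' t)" for t
    using assms[of t] by (metis frechet_derivative_at has_field_derivative_def)
  then have "C_diff (Suc k) \<alpha> \<longleftrightarrow> C_diff k \<alpha>'" for k
    using assms by (auto simp: has_field_derivative_def differentiable_def)
  then show ?thesis unfolding smooth_def by (metis C_diff_Suc_imp)
qed

lemma smooth_has_derivative:
  assumes "smooth \<psi>"
  shows "(\<psi> has_derivative frechet_derivative \<psi> (at x)) (at x)"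
  using assms unfolding smooth_def by (metis C_diff_has_derivative)

lemma smooth_has_real_derivative:
  fixes \<alpha> :: "real \<Rightarrow> real"
  assumes "smooth \<alpha>"
  shows "(\<alpha> has_real_derivative frechet_derivative \<alpha> (at t) 1) (at t)"
proof -
  have "(\<alpha> has_derivative frechet_derivative \<alpha> (at t)) (at t)"
    using assms by (rule smooth_has_derivative)
  then obtain D where "(\<alpha> has_real_derivative D) (at t)" 
    using has_derivative_imp_has_field_derivative by (metis real_differentiableE real_differentiable_def differentiable_def)
  then show ?thesis by (metis frechet_derivative_at has_field_derivative_def mult.right_neutral)
qed

lemma smooth_frechet_derivative:
  "smooth \<psi> \<Longrightarrow> b \<in> Basis \<Longrightarrow> smooth (\<lambda>x. frechet_derivative \<psi> (at x) b)"
  unfolding smooth_def by (metis C_diff.simps(2))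

lemma smooth_continuous: "smooth \<psi> \<Longrightarrow> continuous_on S \<psi>"
  unfolding smooth_def by (metis C_diff.simps(1) continuous_on_subset subset_UNIV)

text \<open>The derivative in direction \<open>b\<close> is again of this form, with \<open>\<alpha>\<close> replaced by its
  derivative and a constant factor in front, so the induction on the order of
  differentiability generalizes over \<open>\<alpha>\<close>.\<close>

lemma smooth_compose_inner:
  fixes w :: "'a::euclidean_space" and \<alpha> :: "real \<Rightarrow> real"
  assumes "smooth \<alpha>"
  shows "smooth (\<lambda>x. \<alpha> (x \<bullet> w + d))"
proof -
  have "C_diff k (\<lambda>x. \<alpha> (x \<bullet> w + d))" if "smooth \<alpha>" for k \<alpha>
    using that
  proof (induction k arbitrary: \<alpha>)
    case 0
    then show ?case
      by (auto intro!: continuous_intros continuous_on_compose2[OF smooth_continuous[of \<alpha> UNIV]])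
  next
    case (Suc k)
    let ?D = "\<lambda>t. frechet_derivative \<alpha> (at t) 1"
    show ?case
    proof (rule C_diff_SucI[where \<psi>' = "\<lambda>x h. (h \<bullet> w) * ?D (x \<bullet> w + d)"])
      have "((\<lambda>x. \<alpha> (x \<bullet> w + d)) has_derivative (\<lambda>h. ?D (x \<bullet> w + d) * (h \<bullet> w))) (at x)" for x
      proof (rule has_derivative_compose[where f = "\<lambda>x. x \<bullet> w + d"
            and f' = "\<lambda>h. h \<bullet> w" and g' = "(*) (?D (x \<bullet> w + d))"])
        show "((\<lambda>x. x \<bullet> w + d) has_derivative (\<lambda>h. h \<bullet> w)) (at x)"
          by (auto intro!: derivative_eq_intros)
        show "(\<alpha> has_derivative (*) (?D (x \<bullet> w + d))) (at (x \<bullet> w + d))"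
          using smooth_has_real_derivative[OF Suc.prems, of "x \<bullet> w + d"]
          by (simp add: has_field_derivative_def)
      qed
      then show "((\<lambda>x. \<alpha> (x \<bullet> w + d)) has_derivative (\<lambda>h. (h \<bullet> w) * ?D (x \<bullet> w + d))) (at x)" for x
        by (simp add: mult.commute)
      show "C_diff k (\<lambda>x. (b \<bullet> w) * ?D (x \<bullet> w + d))" for b
        by (intro C_diff_mult C_diff_const Suc.IH smooth_frechet_derivative Suc.prems) auto
    qed
  qed
  then show ?thesis using assms by (auto simp: smooth_def)
qed

section \<open>A smooth transition from zero to one\<close>

text \<open>For \<open>p = 1\<close> this is the classical smooth function \<open>exp (- 1 / t)\<close> which vanishes to
  infinite order at \<open>0\<close>. The polynomial factor makes the family closed under differentiation.\<close>

definition flat :: "real poly \<Rightarrow> real \<Rightarrow> real" where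
  "flat p t = (if t > 0 then poly p (1 / t) * exp (- (1 / t)) else 0)"

text \<open>Substituting \<open>s = 1 / t\<close>, this is the fact that the exponential function outgrows every
  polynomial.\<close>

lemma flat_tendsto_0: "(flat p \<longlongrightarrow> 0) (at_right 0)"
proof -
  have "((\<lambda>s. poly p s * exp (- s)) \<longlongrightarrow> 0) at_top"
  proof (induction p)
    case (pCons a p)
    have 1: "((\<lambda>s::real. exp (- s)) \<longlongrightarrow> 0) at_top"
      using tendsto_power_div_exp_0[of 0] by (simp add: exp_minus field_simps)
    have "((\<lambda>s. (\<Sum>i\<le>degree p. coeff p i * (s ^ Suc i / exp s))) \<longlongrightarrow> (\<Sum>i\<le>degree p. coeff p i * 0)) at_top"
      by (intro tendsto_intros tendsto_power_div_exp_0)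
    then have "((\<lambda>s. s * poly p s * exp (- s)) \<longlongrightarrow> 0) at_top"
      by (simp add: poly_altdef sum_distrib_left sum_distrib_right exp_minus field_simps)
    from tendsto_add[OF tendsto_mult_left[OF 1, of a] this] show ?case
      by (simp add: algebra_simps)
  qed auto
  then have "((\<lambda>t. poly p (inverse t) * exp (- inverse t)) \<longlongrightarrow> 0) (at_right 0)"
    by (rule filterlim_compose[OF _ filterlim_inverse_at_top_right])
  then show ?thesis
    by (rule Lim_transform_eventually)
       (auto simp: flat_def eventually_at_right_field inverse_eq_divide intro!: exI[of _ 1])
qed

text \<open>With \<open>X\<close> standing for \<open>1 / t\<close>, whose derivative is \<open>- X\<^sup>2\<close>, the product rule turns
  \<open>p exp (- X)\<close> into \<open>X\<^sup>2 (p - p') exp (- X)\<close>.\<close>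

definition flat_pderiv :: "real poly \<Rightarrow> real poly" where
  "flat_pderiv p = monom 1 2 * (p - pderiv p)"

lemma flat_has_derivative: "(flat p has_real_derivative flat (flat_pderiv p) t) (at t)"
proof -
  consider "t > 0" | "t < 0" | "t = 0" by linarith
  then show ?thesis
  proof cases
    case 1
    have "((\<lambda>t. poly p (1 / t) * exp (- (1 / t))) has_real_derivative flat (flat_pderiv p) t) (at t)"
      using 1 by (auto intro!: derivative_eq_intros DERIV_chain2[OF poly_DERIV]
          simp: flat_def flat_pderiv_def poly_monom power2_eq_square field_simps)
    then show ?thesis
      by (rule has_field_derivative_transform_within_open[of _ _ _ "{0<..}"]) (use 1 in \<open>auto simp: flat_def\<close>)
  next
    case 2
    have "((\<lambda>t. 0) has_real_derivative flat (flat_pderiv p) t) (at t)"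
      using 2 by (auto simp: flat_def)
    then show ?thesis
      by (rule has_field_derivative_transform_within_open[of _ _ _ "{..<0}"]) (use 2 in \<open>auto simp: flat_def\<close>)
  next
    case 3
    have "((\<lambda>t. (flat p t - flat p 0) / (t - 0)) \<longlongrightarrow> 0) (at_right 0)"
      using flat_tendsto_0[of "pCons 0 p"]
      by (rule Lim_transform_eventually)
         (auto simp: flat_def eventually_at_right_field intro!: exI[of _ 1])
    moreover have "((\<lambda>t. (flat p t - flat p 0) / (t - 0)) \<longlongrightarrow> 0) (at_left 0)"
      by (rule Lim_transform_eventually[OF tendsto_const])
         (auto simp: flat_def eventually_at_left_field intro!: exI[of _ "-1"])
    ultimately have "((\<lambda>t. (flat p t - flat p 0) / (t - 0)) \<longlongrightarrow> 0) (at 0)"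
      by (simp add: filterlim_split_at)
    then show ?thesis using 3 by (simp add: has_field_derivative_iff flat_def)
  qed
qed

lemma smooth_flat: "smooth (flat p)"
proof -
  have "C_diff k (flat p)" for k
  proof (induction k arbitrary: p)
    case 0
    show ?case using flat_has_derivative
      by (auto simp: continuous_on_eq_continuous_at intro: DERIV_isCont)
  next
    case (Suc k)
    show ?case
      by (rule C_diff_SucI[where \<psi>' = "\<lambda>t h. flat (flat_pderiv p) t * h"])
         (use flat_has_derivative[of p] Suc in \<open>auto simp: has_field_derivative_def\<close>)
  qed
  then show ?thesis by (simp add: smooth_def)
qed

lemma smooth_affine:
  fixes \<alpha> :: "real \<Rightarrow> real"
  shows "smooth \<alpha> \<Longrightarrow> smooth (\<lambda>t. \<alpha> (c * t + d))"
  using smooth_compose_inner[of \<alpha> c d] by (simp add: mult.commute)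

text \<open>The normalized antiderivative of the bump \<open>exp (- 1 / t) exp (- 1 / (1 - t))\<close> on the unit
  interval. Working with the antiderivative rather than with the bump keeps control of the derivative
  \<open>\<rho>\<close>: it is a smooth mass concentrated on the unit interval.\<close>

lemma smooth_step_exists:
  "\<exists>P \<rho>. smooth P \<and> smooth \<rho> \<and> (\<forall>t::real. (P has_real_derivative \<rho> t) (at t)) \<and>
     (\<forall>t. \<rho> t \<noteq> 0 \<longrightarrow> t \<in> {0<..<1}) \<and> (\<forall>t\<le>0. P t = 0) \<and> (\<forall>t\<ge>1. P t = 1) \<and> (\<forall>t. 0 \<le> P t \<and> P t \<le> (1::real))"
proof -
  define \<sigma> :: "real \<Rightarrow> real" where "\<sigma> = (\<lambda>t. flat 1 t * flat 1 ((-1) * t + 1))"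
  have s: "smooth \<sigma>" unfolding \<sigma>_def by (intro smooth_mult smooth_affine smooth_flat)
  have s0: "\<sigma> t \<ge> 0" for t by (auto simp: \<sigma>_def flat_def)
  have spos: "\<sigma> t > 0 \<longleftrightarrow> t \<in> {0<..<1}" for t by (auto simp: \<sigma>_def flat_def)
  have sz: "\<sigma> t = 0" if "t \<notin> {0<..<1}" for t using that s0[of t] spos[of t] by force
  \<comment> \<open>The lower limit lies to the left of the support, so that \<open>Q\<close> is differentiable at \<open>0\<close> from both sides.\<close>
  define Q where "Q t = integral {-1..t} \<sigma>" for t
  have Q0: "Q t = 0" if "t \<le> 0" for t
  proof -
    have "integral {-1..t} \<sigma> = integral {-1..t} (\<lambda>_. 0)"
      using that by (intro integral_cong sz) auto
    then show ?thesis by (simp add: Q_def)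
  qed
  have Qd: "(Q has_real_derivative \<sigma> t) (at t)" for t
  proof (cases "t > -1")
    case True
    have "(Q has_real_derivative \<sigma> t) (at t within {-1..t+1})"
      unfolding Q_def[abs_def]
      by (rule integral_has_real_derivative) (use True s in \<open>auto intro: smooth_continuous\<close>)
    moreover have "t \<in> interior {-1..t+1}" using True by (simp add: interior_atLeastAtMost_real)
    ultimately show ?thesis by (metis at_within_interior)
  next
    case False
    have "((\<lambda>_. 0) has_real_derivative \<sigma> t) (at t)" using False sz by auto
    then show ?thesis
      by (rule has_field_derivative_transform_within_open[of _ _ _ "{..<0}"]) (use False Q0 in auto)
  qed
  have Qc: "continuous_on S Q" for S
    by (rule DERIV_continuous_on[OF has_field_derivative_at_within[OF Qd]])
  have "Q 0 < Q 1"
  proof (rule DERIV_pos_imp_increasing_open[OF zero_less_one _ Qc])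
    show "\<exists>y. DERIV Q t :> y \<and> y > 0" if "0 < t" "t < 1" for t
      by (intro exI[of _ "\<sigma> t"] conjI Qd) (use spos[of t] that in simp)
  qed
  then have c: "Q 1 > 0" using Q0 by simp
  have mono: "Q s \<le> Q t" if "s \<le> t" for s t
  proof (rule DERIV_nonneg_imp_nondecreasing[OF that])
    show "\<exists>y. DERIV Q x :> y \<and> y \<ge> 0" for x
      using Qd[of x] s0[of x] by (intro exI[of _ "\<sigma> x"]) simp
  qed
  have Q1: "Q t = Q 1" if "t \<ge> 1" for t
  proof (cases "t = 1")
    case False
    then have "1 < t" using that by simp
    then show ?thesis
    proof (rule DERIV_isconst_end[OF _ Qc])
      show "DERIV Q x :> 0" if "1 < x" "x < t" for x
        using Qd[of x] sz[of x] that by simp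
    qed
  qed auto
  define P \<rho> where "P = (\<lambda>t. 1 / Q 1 * Q t)" and "\<rho> = (\<lambda>t. 1 / Q 1 * \<sigma> t)"
  have Pd: "(P has_real_derivative \<rho> t) (at t)" for t
    unfolding P_def \<rho>_def by (intro DERIV_cmult Qd)
  have "smooth \<rho>" unfolding \<rho>_def by (intro smooth_mult smooth_const s)
  moreover have "smooth P" using smooth_iff_real[OF Pd] calculation by simp
  moreover have "\<forall>t. 0 \<le> P t \<and> P t \<le> 1"
  proof
    fix t
    have "Q t \<le> Q 1" using mono[of t 1] Q1[of t] by fastforce
    moreover have "Q t \<ge> 0" using mono[of 0 t] Q0[of t] Q0[of 0] by fastforce
    ultimately show "0 \<le> P t \<and> P t \<le> 1" using c by (simp add: P_def)
  qed
  moreover have "\<forall>t\<ge>1. P t = 1"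
  proof (intro allI impI)
    fix t :: real
    assume "t \<ge> 1"
    then have "Q t = Q 1" by (rule Q1)
    then show "P t = 1" using c by (simp add: P_def)
  qed
  moreover have "\<forall>t. \<rho> t \<noteq> 0 \<longrightarrow> t \<in> {0<..<1}" using sz by (auto simp: \<rho>_def)
  moreover have "\<forall>t\<le>0. P t = 0" using Q0 by (simp add: P_def)
  ultimately show ?thesis using Pd by (intro exI[of _ P] exI[of _ \<rho>]) simp
qed

definition smooth_step :: "real \<Rightarrow> real" where
  "smooth_step = (SOME P. smooth P \<and> (\<forall>t. deriv P t \<noteq> 0 \<longrightarrow> t \<in> {0<..<1}) \<and>
     (\<forall>t\<le>0. P t = 0) \<and> (\<forall>t\<ge>1. P t = 1) \<and> (\<forall>t. 0 \<le> P t \<and> P t \<le> 1))"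

lemma smooth_step:
  shows smooth_smooth_step: "smooth smooth_step"
    and deriv_smooth_step: "deriv smooth_step t \<noteq> 0 \<Longrightarrow> t \<in> {0<..<1}"
    and smooth_step_eq_0: "t \<le> 0 \<Longrightarrow> smooth_step t = 0"
    and smooth_step_eq_1: "t \<ge> 1 \<Longrightarrow> smooth_step t = 1"
    and smooth_step_nonneg: "0 \<le> smooth_step t"
    and smooth_step_le_1: "smooth_step t \<le> 1"
proof -
  have "\<exists>P. smooth P \<and> (\<forall>t. deriv P t \<noteq> 0 \<longrightarrow> t \<in> {0<..<1}) \<and>
     (\<forall>t\<le>0. P t = 0) \<and> (\<forall>t\<ge>1. P t = 1) \<and> (\<forall>t::real. 0 \<le> P t \<and> P t \<le> (1::real))"
  proof -
    obtain P \<rho> where P: "smooth P" "\<forall>t::real. (P has_real_derivative \<rho> t) (at t)"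
        "\<forall>t. \<rho> t \<noteq> 0 \<longrightarrow> t \<in> {0<..<1}" "\<forall>t\<le>0. P t = 0" "\<forall>t\<ge>1. P t = 1"
        "\<forall>t. 0 \<le> P t \<and> P t \<le> (1::real)"
      using smooth_step_exists by (elim exE conjE)
    have "deriv P t = \<rho> t" for t using P(2) by (intro DERIV_imp_deriv) simp
    then show ?thesis using P by (intro exI[of _ P]) simp
  qed
  from someI_ex[OF this, folded smooth_step_def]
  show "smooth smooth_step" "deriv smooth_step t \<noteq> 0 \<Longrightarrow> t \<in> {0<..<1}"
    "t \<le> 0 \<Longrightarrow> smooth_step t = 0" "t \<ge> 1 \<Longrightarrow> smooth_step t = 1"
    "0 \<le> smooth_step t" "smooth_step t \<le> 1"
    by auto
qed

lemma smooth_DERIV: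
  fixes \<alpha> :: "real \<Rightarrow> real"
  assumes "smooth \<alpha>"
  shows "(\<alpha> has_real_derivative deriv \<alpha> t) (at t)"
    and "frechet_derivative \<alpha> (at t) 1 = deriv \<alpha> t"
  using smooth_has_real_derivative[OF assms, of t] DERIV_imp_deriv[OF smooth_has_real_derivative[OF assms, of t]]
  by simp_all

lemma smooth_deriv:
  fixes \<alpha> :: "real \<Rightarrow> real"
  shows "smooth \<alpha> \<Longrightarrow> smooth (deriv \<alpha>)"
  using smooth_iff_real[OF smooth_DERIV(1)] by blast

text \<open>A smooth approximation of the indicator of the interval from \<open>l\<close> to \<open>u\<close>: it climbs to one
  just to the right of \<open>l\<close> and comes back to zero just to the left of \<open>u\<close>, each within a distance
  \<open>1 / n\<close>. The shift by one in the second term keeps the descent inside the interval. The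
  derivative is then a difference of two rescaled unit masses, one at each end of the interval.\<close>

definition plateau :: "real \<Rightarrow> real \<Rightarrow> real \<Rightarrow> real \<Rightarrow> real" where
  "plateau l u n t = smooth_step (n * (t - l)) - smooth_step (n * (t - u) + 1)"

lemma smooth_plateau: "smooth (plateau l u n)"
proof -
  have "smooth (\<lambda>t. smooth_step (n * t + (- n * l)) + (- 1) * smooth_step (n * t + (1 - n * u)))"
    by (intro smooth_add smooth_mult smooth_const smooth_affine smooth_smooth_step)
  then show ?thesis by (simp add: plateau_def[abs_def] algebra_simps)
qed

lemma deriv_plateau:
  "deriv (plateau l u n) t
     = n * deriv smooth_step (n * (t - l)) - n * deriv smooth_step (n * (t - u) + 1)"
proof (rule DERIV_imp_deriv)
  show "(plateau l u n has_real_derivative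
      n * deriv smooth_step (n * (t - l)) - n * deriv smooth_step (n * (t - u) + 1)) (at t)"
    unfolding plateau_def[abs_def]
    by (auto intro!: derivative_eq_intros DERIV_chain2[OF smooth_DERIV(1)[OF smooth_smooth_step]]
        simp: algebra_simps)
qed

lemma abs_plateau_le_1: "\<bar>plateau l u n t\<bar> \<le> 1"
  using smooth_step_nonneg[of "n * (t - l)"] smooth_step_le_1[of "n * (t - l)"]
    smooth_step_nonneg[of "n * (t - u) + 1"] smooth_step_le_1[of "n * (t - u) + 1"]
  unfolding plateau_def by linarith

text \<open>The second assumption on \<open>n\<close> makes the interval long enough for the ascent and the descent
  not to overlap. Without it the descent could begin to the left of \<open>l\<close>.\<close>

lemma plateau_eq_0:
  assumes n: "n > 0" "1 \<le> n * (u - l)" and t: "t \<notin> {l<..<u}"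
  shows "plateau l u n t = 0"
proof (cases "t \<le> l")
  case True
  then have a: "n * (t - l) \<le> 0" using n by (simp add: mult_nonneg_nonpos)
  moreover have "n * (t - u) + 1 = n * (t - l) + (1 - n * (u - l))" by (simp add: algebra_simps)
  ultimately show ?thesis using n by (simp add: plateau_def smooth_step_eq_0)
next
  case False
  then have a: "n * (t - u) \<ge> 0" using n t by simp
  moreover have "n * (t - l) = n * (t - u) + n * (u - l)" by (simp add: algebra_simps)
  ultimately show ?thesis using n by (simp add: plateau_def smooth_step_eq_1)
qed

lemma deriv_plateau_eq_0:
  assumes n: "n > 0" "1 \<le> n * (u - l)" and t: "t \<notin> {l<..<u}"
  shows "deriv (plateau l u n) t = 0"
proof -
  have eq: "n * (t - l) = n * (t - u) + n * (u - l)" by (simp add: algebra_simps)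
  have "t \<le> l \<or> t \<ge> u" using t by auto
  then have "n * (t - l) \<le> 0 \<or> n * (t - u) \<ge> 0"
    using n by (auto simp: mult_le_0_iff zero_le_mult_iff)
  then have "n * (t - l) \<notin> {0<..<1}" "n * (t - u) + 1 \<notin> {0<..<1}"
    using eq n by auto
  then have "deriv smooth_step (n * (t - l)) = 0" "deriv smooth_step (n * (t - u) + 1) = 0"
    using deriv_smooth_step by blast+
  then show ?thesis by (simp add: deriv_plateau)
qed

lemma tendsto_plateau:
  assumes "l < u"
  shows "(\<lambda>n. plateau l u (real n) t) \<longlonglongrightarrow> indicator {l<..<u} t"
proof (cases "t \<in> {l<..<u}")
  case True
  then have "filterlim (\<lambda>n. real n * (t - l)) at_top sequentially"
    "filterlim (\<lambda>n. real n * (u - t)) at_top sequentially"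
    by (auto intro!: filterlim_at_top_mult_tendsto_pos[OF tendsto_const] filterlim_real_sequentially)
  then have "eventually (\<lambda>n. real n * (t - l) \<ge> 1) sequentially"
      "eventually (\<lambda>n. real n * (u - t) \<ge> 1) sequentially"
    by (auto simp: filterlim_at_top)
  then have "eventually (\<lambda>n. plateau l u (real n) t = 1) sequentially"
    by eventually_elim (simp add: plateau_def smooth_step_eq_1 smooth_step_eq_0 algebra_simps)
  then show ?thesis using True by (simp add: tendsto_eventually)
next
  case False
  from assms have "filterlim (\<lambda>n. real n * (u - l)) at_top sequentially"
    by (auto intro!: filterlim_at_top_mult_tendsto_pos[OF tendsto_const] filterlim_real_sequentially)
  then have "eventually (\<lambda>n. real n * (u - l) \<ge> 1) sequentially"
    by (auto simp: filterlim_at_top)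
  then have "eventually (\<lambda>n. plateau l u (real n) t = 0) sequentially"
    using eventually_gt_at_top[of 0]
    by eventually_elim (use False in \<open>simp add: plateau_eq_0\<close>)
  then show ?thesis using False by (simp add: tendsto_eventually)
qed

section \<open>Tensor products of functions of one variable\<close>

text \<open>The choice of the factor is indexed by the basis vectors themselves, so that products over
  all coordinates make sense in every Euclidean space.\<close>

definition tensor :: "('a::euclidean_space \<Rightarrow> real \<Rightarrow> real) \<Rightarrow> 'a \<Rightarrow> real" where
  "tensor \<alpha> x = (\<Prod>b\<in>Basis. \<alpha> b (x \<bullet> b))"

lemma tensor_fun_upd:
  "j \<in> Basis \<Longrightarrow> tensor (\<alpha>(j := \<beta>)) x = \<beta> (x \<bullet> j) * (\<Prod>b\<in>Basis - {j}. \<alpha> b (x \<bullet> b))"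
  unfolding tensor_def by (subst prod.remove[of _ j]) (auto intro!: prod.cong)

lemma smooth_tensor:
  assumes "\<And>b. b \<in> Basis \<Longrightarrow> smooth (\<alpha> b)"
  shows "smooth (tensor \<alpha>)"
  unfolding tensor_def[abs_def]
proof (rule smooth_prod)
  show "smooth (\<lambda>x. \<alpha> b (x \<bullet> b))" if "b \<in> Basis" for b
    using smooth_compose_inner[OF assms[OF that], of b 0] by simp
qed

lemma frechet_derivative_tensor:
  assumes "\<And>b. b \<in> Basis \<Longrightarrow> smooth (\<alpha> b)" and j: "j \<in> Basis"
  shows "frechet_derivative (tensor \<alpha>) (at x) j = tensor (\<alpha>(j := deriv (\<alpha> j))) x"
proof -
  have d: "((\<lambda>x. \<alpha> b (x \<bullet> b)) has_derivative (\<lambda>h. deriv (\<alpha> b) (x \<bullet> b) * (h \<bullet> b))) (at x)"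
    if "b \<in> Basis" for b
  proof (rule has_derivative_compose[where f = "\<lambda>x. x \<bullet> b" and f' = "\<lambda>h. h \<bullet> b"
        and g' = "(*) (deriv (\<alpha> b) (x \<bullet> b))"])
    show "((\<lambda>x. x \<bullet> b) has_derivative (\<lambda>h. h \<bullet> b)) (at x)"
      by (auto intro!: derivative_eq_intros)
    show "(\<alpha> b has_derivative (*) (deriv (\<alpha> b) (x \<bullet> b))) (at (x \<bullet> b))"
      using smooth_DERIV(1)[OF assms(1)[OF that]] by (simp add: has_field_derivative_def)
  qed
  have "(tensor \<alpha> has_derivative (\<lambda>h. \<Sum>i\<in>Basis. deriv (\<alpha> i) (x \<bullet> i) * (h \<bullet> i) *
      (\<Prod>b\<in>Basis - {i}. \<alpha> b (x \<bullet> b)))) (at x)"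
    unfolding tensor_def[abs_def] by (rule has_derivative_prod[OF d])
  then have "frechet_derivative (tensor \<alpha>) (at x) j = (\<Sum>i\<in>Basis. deriv (\<alpha> i) (x \<bullet> i) * (j \<bullet> i) *
      (\<Prod>b\<in>Basis - {i}. \<alpha> b (x \<bullet> b)))"
    by (rule arg_cong[OF frechet_derivative_at[symmetric], of _ _ _ "\<lambda>f. f j"])
  also have "\<dots> = (\<Sum>i\<in>Basis. if i = j then tensor (\<alpha>(j := deriv (\<alpha> j))) x else 0)"
    
  proof (rule sum.cong)
    fix i :: 'a
    assume i: "i \<in> Basis"
    show "deriv (\<alpha> i) (x \<bullet> i) * (j \<bullet> i) * (\<Prod>b\<in>Basis - {i}. \<alpha> b (x \<bullet> b))
        = (if i = j then tensor (\<alpha>(j := deriv (\<alpha> j))) x else 0)"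
      using i j by (simp add: tensor_fun_upd inner_Basis)
  qed simp
  finally show ?thesis using j by simp
qed

lemma test_functionsI:
  assumes "smooth \<psi>" "compact K" "K \<subseteq> U" "\<And>x. \<psi> x \<noteq> 0 \<Longrightarrow> x \<in> K"
  shows "\<psi> \<in> test_functions U"
proof -
  have "closure {x. \<psi> x \<noteq> 0} \<subseteq> K"
    using assms by (intro closure_minimal compact_imp_closed) auto
  moreover then have "compact (closure {x. \<psi> x \<noteq> 0})"
    using assms(2) by (meson closed_closure compact_imp_bounded bounded_subset compact_eq_bounded_closed)
  ultimately show ?thesis using assms by (auto simp: test_functions_def smooth_def)
qed

lemma tensor_in_test_functions:
  assumes "\<And>b. b \<in> Basis \<Longrightarrow> smooth (\<alpha> b)" "cbox p q \<subseteq> U"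
    and "\<And>b t. b \<in> Basis \<Longrightarrow> \<alpha> b t \<noteq> 0 \<Longrightarrow> p \<bullet> b \<le> t \<and> t \<le> q \<bullet> b"
  shows "tensor \<alpha> \<in> test_functions U"
proof (rule test_functionsI[OF smooth_tensor compact_cbox assms(2)])
  show "x \<in> cbox p q" if "tensor \<alpha> x \<noteq> 0" for x
    using that assms(3) by (auto simp: mem_box tensor_def)
qed (use assms in auto)

lemma AE_inner_Basis:
  assumes "AE t in lborel. P t" and b: "b \<in> Basis"
  shows "AE x::'a::euclidean_space in lborel. P (x \<bullet> b)"
proof -
  from assms(1) obtain N where N: "{t. \<not> P t} \<subseteq> N" "N \<in> null_sets lborel"
    by (auto elim!: AE_E simp: null_sets_def)
  then have [measurable]: "N \<in> sets borel" by auto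
  \<comment> \<open>The null set times the remaining axes: one vanishing factor makes the product zero, even if others are infinite.\<close>
  let ?f = "\<lambda>c t. if c = b then indicator N t else (1::ennreal)"
  have "emeasure lborel {x::'a. x \<bullet> b \<in> N} = (\<integral>\<^sup>+x. (\<Prod>c\<in>Basis. ?f c (x \<bullet> c)) \<partial>lborel)"
  proof (subst nn_integral_indicator[symmetric])
    show "{x::'a. x \<bullet> b \<in> N} \<in> sets lborel" by measurable
    show "integral\<^sup>N lborel (indicator {x::'a. x \<bullet> b \<in> N}) = (\<integral>\<^sup>+x. (\<Prod>c\<in>Basis. ?f c (x \<bullet> c)) \<partial>lborel)"
      using b by (intro nn_integral_cong) (auto simp: prod.remove[of _ b] indicator_def)
  qed
  also have "\<dots> = (\<Prod>c\<in>Basis. (\<integral>\<^sup>+t. ?f c t \<partial>lborel))"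
    by (rule nn_integral_lborel_prod) auto
  also have "\<dots> = 0"
    using b N(2) by (intro prod_zero) (auto intro!: bexI[of _ b])
  finally have "{x::'a. x \<bullet> b \<in> N} \<in> null_sets lborel" by (simp add: null_sets_def)
  then show ?thesis by (rule AE_I') (use N in auto)
qed

text \<open>Lebesgue measure on a Euclidean space is the image of the product of the Lebesgue measures of
  the coordinate axes, so this is Fubini's theorem for functions with separated variables.\<close>

lemma tensor_integral_lborel:
  fixes g :: "'a::euclidean_space \<Rightarrow> real \<Rightarrow> real"
  assumes "\<And>b. b \<in> Basis \<Longrightarrow> integrable lborel (g b)"
  shows "integrable lborel (tensor g)" and "(LINT x|lborel. tensor g x) = (\<Prod>b\<in>Basis. LINT t|lborel. g b t)"
proof -
  interpret product_sigma_finite "\<lambda>_::'a. lborel :: real measure" ..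
  have [measurable]: "g b \<in> borel_measurable borel" if "b \<in> Basis" for b
    using assms[OF that] by (auto dest: borel_measurable_integrable)
  have [measurable]: "tensor g \<in> borel_measurable borel"
    unfolding tensor_def[abs_def] by measurable
  have m: "(\<lambda>f. \<Sum>b\<in>Basis. f b *\<^sub>R b) \<in> (\<Pi>\<^sub>M b\<in>Basis. lborel) \<rightarrow>\<^sub>M (borel :: 'a measure)"
    by measurable
  have e: "tensor g (\<Sum>b\<in>Basis. f b *\<^sub>R b) = (\<Prod>b\<in>Basis. g b (f b))" for f
    unfolding tensor_def by (intro prod.cong) auto
  show "integrable lborel (tensor g)"
    by (subst lborel_eq, subst integrable_distr_eq[OF m])
       (auto simp: e intro!: product_integrable_prod assms)
  show "(LINT x|lborel. tensor g x) = (\<Prod>b\<in>Basis. LINT t|lborel. g b t)"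
    by (subst lborel_eq, subst integral_distr[OF m])
       (auto simp: e intro!: product_integral_prod assms)
qed

text \<open>The same for Lebesgue measurable factors. Each factor agrees almost everywhere with a Borel
  function, and null sets of a coordinate axis pull back to null sets of the whole space.\<close>

lemma tensor_integral:
  fixes g :: "'a::euclidean_space \<Rightarrow> real \<Rightarrow> real"
  assumes "\<And>b. b \<in> Basis \<Longrightarrow> integrable lebesgue (g b)"
  shows "integrable lebesgue (tensor g)"
    and "(LINT x|lebesgue. tensor g x) = (\<Prod>b\<in>Basis. LINT t|lebesgue. g b t)"
proof -
  have "\<forall>b\<in>Basis. \<exists>h\<in>borel_measurable lborel. AE t in lborel. g b t = h t"
    using assms by (intro ballI completion_ex_borel_measurable_real) auto
  then obtain h where h: "\<And>b. b \<in> Basis \<Longrightarrow> h b \<in> borel_measurable lborel"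
      "\<And>b. b \<in> Basis \<Longrightarrow> AE t in lborel. g b t = h b t"
    by metis
  have hL: "h b \<in> borel_measurable lebesgue" if "b \<in> Basis" for b
    using h(1)[OF that] by (rule measurable_completion)
  have i: "integrable lborel (h b)" "(LINT t|lborel. h b t) = (LINT t|lebesgue. g b t)"
    if b: "b \<in> Basis" for b
  proof -
    have ae: "AE t in lebesgue. g b t = h b t" using h(2)[OF b] by (rule AE_completion)
    have "integrable lebesgue (h b)"
      by (rule integrable_cong_AE_imp[OF assms[OF b] hL[OF b] ae])
    then show "integrable lborel (h b)"
      using h(1)[OF b] by (simp add: integrable_completion)
    show "(LINT t|lborel. h b t) = (LINT t|lebesgue. g b t)"
      by (subst integral_completion[OF h(1)[OF b], symmetric])
         (use ae assms[OF b] hL[OF b] in \<open>intro integral_cong_AE, auto\<close>)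
  qed
  have "AE x in lborel. \<forall>b\<in>Basis. g b (x \<bullet> b) = h b (x \<bullet> b)"
    using h(2) AE_inner_Basis by (subst AE_ball_countable) (auto simp: countable_finite)
  then have "AE x in lborel. tensor h x = tensor g x"
    by eventually_elim (simp add: tensor_def)
  then have ae: "AE x in lebesgue. tensor h x = tensor g x" by (rule AE_completion)
  have hb: "tensor h \<in> borel_measurable lborel"
    using tensor_integral_lborel(1)[of h, OF i(1)] by (rule borel_measurable_integrable)
  have hi: "integrable lebesgue (tensor h)"
    using tensor_integral_lborel(1)[of h, OF i(1)] hb by (simp add: integrable_completion)
  have gb: "tensor g \<in> borel_measurable lebesgue"
    by (rule borel_measurable_AE[OF _ ae]) (use hi in auto)
  show "integrable lebesgue (tensor g)"
    by (rule integrable_cong_AE_imp[OF hi gb]) (use ae in eventually_elim, auto)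
  have "(LINT x|lebesgue. tensor g x) = (LINT x|lebesgue. tensor h x)"
    by (rule integral_cong_AE) (use ae hi gb in \<open>auto elim: eventually_mono\<close>)
  also have "\<dots> = (LINT x|lborel. tensor h x)" by (rule integral_completion[OF hb])
  also have "\<dots> = (\<Prod>b\<in>Basis. LINT t|lebesgue. g b t)"
    using tensor_integral_lborel(2)[of h, OF i(1)] i(2) by (simp cong: prod.cong)
  finally show "(LINT x|lebesgue. tensor g x) = (\<Prod>b\<in>Basis. LINT t|lebesgue. g b t)" .
qed

section \<open>The fundamental lemma of the calculus of variations\<close>

text \<open>Boxes form an intersection-stable generator of the Borel sets, and the sets on which \<open>w\<close>
  integrates to zero form a Dynkin system; so \<open>w\<close> integrates to zero over every Borel set.\<close>

lemma AE_eq_0_if_integral_boxes_eq_0: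
  fixes w :: "'a::euclidean_space \<Rightarrow> real"
  assumes w: "integrable lebesgue w"
    and boxes: "\<And>p q. (LINT x:box p q|lebesgue. w x) = 0"
  shows "AE x in lebesgue. w x = 0"
proof -
  obtain g where g[measurable]: "g \<in> borel_measurable lborel" and ae: "AE x in lborel. w x = g x"
    using w completion_ex_borel_measurable_real[of w lborel] by auto
  have aeL: "AE x in lebesgue. w x = g x" using ae by (rule AE_completion)
  have gL: "g \<in> borel_measurable lebesgue" using g by (rule measurable_completion)
  have "integrable lebesgue g" by (rule integrable_cong_AE_imp[OF w gL aeL])
  then have gi: "integrable lborel g" using g by (simp add: integrable_completion)
  have eq: "(LINT x:A|lborel. g x) = (LINT x:A|lebesgue. w x)" if [measurable]: "A \<in> sets borel" for A
  proof -
    have "(LINT x:A|lborel. g x) = (LINT x:A|lebesgue. g x)"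
      unfolding set_lebesgue_integral_def by (rule integral_completion[symmetric]) measurable
    also have "\<dots> = (LINT x:A|lebesgue. w x)"
      unfolding set_lebesgue_integral_def
      by (rule integral_cong_AE)
         (use aeL gL w in \<open>auto intro!: borel_measurable_times borel_measurable_indicator elim: eventually_mono\<close>)
    finally show ?thesis .
  qed
  have gA: "set_integrable lborel A g" if "A \<in> sets borel" for A
    unfolding set_integrable_def using gi that by (intro integrable_mult_indicator) auto
  let ?E = "range (\<lambda>(p, q). box p q :: 'a set)"
  have b: "sets borel = sigma_sets UNIV ?E" by (simp add: borel_eq_box)
  let ?A = "\<lambda>n::nat. box (- (real n *\<^sub>R One)) (real n *\<^sub>R One) :: 'a set"
  have U: "(LINT x:UNIV|lborel. g x) = 0"
  proof -
    have "incseq ?A"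
      by (intro incseq_SucI subset_box_imp) (auto simp: algebra_simps)
    then have "(\<lambda>n. LINT x:?A n|lborel. g x) \<longlonglongrightarrow> (LINT x:(\<Union>n. ?A n)|lborel. g x)"
      by (intro set_integral_cont_up gA) auto
    then have "(\<lambda>n. 0) \<longlonglongrightarrow> (LINT x:UNIV|lborel. g x)"
      unfolding UN_box_eq_UNIV by (simp add: eq boxes)
    then show ?thesis by (simp add: LIMSEQ_const_iff)
  qed
  have stable: "Int_stable ?E" and sub: "?E \<subseteq> Pow UNIV"
    by (auto simp: Int_stable_def box_Int_box)
  have "(LINT x:A|lborel. g x) = 0" if "A \<in> sets borel" for A
    using stable sub that[unfolded b]
  proof (induction A rule: sigma_sets_induct_disjoint)
    case (compl A)
    then have A: "A \<in> sets borel" using b by auto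
    have "(LINT x:A \<union> (UNIV - A)|lborel. g x) = (LINT x:A|lborel. g x) + (LINT x:UNIV - A|lborel. g x)"
      using A by (intro set_integral_Un gA) auto
    then show ?case using compl U by simp
  next
    case (union A)
    then have "range A \<subseteq> sets borel" using b by auto
    then have "(LINT x:(\<Union>i. A i)|lborel. g x) = (\<Sum>i. LINT x:A i|lborel. g x)"
      using union(1) by (intro lebesgue_integral_countable_add gA) (auto simp: disjoint_family_on_def)
    then show ?case using union by simp
  next
    case (basic A)
    then show ?case using eq[of A] boxes by auto
  qed (simp add: set_lebesgue_integral_def)
  then have "AE x in lborel. g x = 0"
    by (intro sigma_finite_measure.density_zero[OF sigma_finite_lborel] gi) auto
  then have "AE x in lborel. w x = 0" using ae by eventually_elim simp
  then show ?thesis by (rule AE_completion)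
qed

text \<open>Let \<open>n\<close> tend to infinity: the products of plateau functions converge boundedly to the
  indicator of the box.\<close>

lemma fundamental_lemma_box:
  fixes v :: "'a::euclidean_space \<Rightarrow> real"
  assumes sub: "cbox p q \<subseteq> U" and lt: "\<And>b. b \<in> Basis \<Longrightarrow> p \<bullet> b < q \<bullet> b"
    and v: "v absolutely_integrable_on cbox p q"
    and test: "\<And>n. n > 0 \<Longrightarrow> (\<And>b. b \<in> Basis \<Longrightarrow> 1 \<le> n * (q \<bullet> b - p \<bullet> b)) \<Longrightarrow>
      (LINT x:U|lebesgue. v x * tensor (\<lambda>b. plateau (p \<bullet> b) (q \<bullet> b) n) x) = 0"
  shows "(LINT x:box p q|lebesgue. v x) = 0"
proof -
  let ?\<psi> = "\<lambda>n. tensor (\<lambda>b. plateau (p \<bullet> b) (q \<bullet> b) (real n))"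
  let ?w = "\<lambda>x. indicator (cbox p q) x * v x"
  have w: "integrable lebesgue ?w" using v by (simp add: set_integrable_def)
  have lim: "(\<lambda>n. ?\<psi> n x) \<longlonglongrightarrow> indicator (box p q) x" for x
  proof -
    have "(\<lambda>n. ?\<psi> n x) \<longlonglongrightarrow> (\<Prod>b\<in>Basis. indicator {p \<bullet> b<..<q \<bullet> b} (x \<bullet> b))"
      unfolding tensor_def by (intro tendsto_prod tendsto_plateau lt)
    also have "(\<Prod>b\<in>Basis. indicator {p \<bullet> b<..<q \<bullet> b} (x \<bullet> b)) = (indicator (box p q) x :: real)"
      by (auto simp: indicator_def mem_box)
    finally show ?thesis .
  qed
  have le1: "\<bar>?\<psi> n x\<bar> \<le> 1" for n x
    unfolding tensor_def abs_prod by (intro prod_le_1) (simp add: abs_plateau_le_1)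
  have "(\<lambda>n. LINT x|lebesgue. ?w x * ?\<psi> n x) \<longlonglongrightarrow> (LINT x|lebesgue. ?w x * indicator (box p q) x)"
  proof (rule integral_dominated_convergence[where w = "\<lambda>x. \<bar>?w x\<bar>"])
    show "AE x in lebesgue. (\<lambda>n. ?w x * ?\<psi> n x) \<longlonglongrightarrow> ?w x * indicator (box p q) x"
      by (intro AE_I2 tendsto_mult_left lim)
    show "AE x in lebesgue. norm (?w x * ?\<psi> n x) \<le> \<bar>?w x\<bar>" for n
      using le1[of n] by (intro AE_I2) (auto simp: abs_mult intro: mult_left_le)
    have "?\<psi> n \<in> borel_measurable borel" for n
      by (intro borel_measurable_continuous_onI smooth_continuous smooth_tensor smooth_plateau)
    then have "?\<psi> n \<in> borel_measurable lebesgue" for n by (simp add: measurable_completion)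
    then show "(\<lambda>x. ?w x * ?\<psi> n x) \<in> borel_measurable lebesgue" for n
      by (intro borel_measurable_times[OF borel_measurable_integrable[OF w]])
    show "(\<lambda>x. ?w x * indicator (box p q) x) \<in> borel_measurable lebesgue"
      by (intro borel_measurable_times[OF borel_measurable_integrable[OF w]] borel_measurable_indicator) simp
  qed (use w in auto)
  moreover have "eventually (\<lambda>n. (LINT x|lebesgue. ?w x * ?\<psi> n x) = 0) sequentially"
  proof -
    have "eventually (\<lambda>n. \<forall>b\<in>Basis. 1 \<le> real n * (q \<bullet> b - p \<bullet> b)) sequentially"
    proof (intro eventually_ball_finite ballI finite_Basis)
      fix b :: 'a
      assume "b \<in> Basis"
      then have "filterlim (\<lambda>n. real n * (q \<bullet> b - p \<bullet> b)) at_top sequentially"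
        using lt by (intro filterlim_at_top_mult_tendsto_pos[OF tendsto_const] filterlim_real_sequentially) auto
      then show "eventually (\<lambda>n. 1 \<le> real n * (q \<bullet> b - p \<bullet> b)) sequentially"
        by (auto simp: filterlim_at_top)
    qed
    then show ?thesis
      using eventually_gt_at_top[of 0]
    proof eventually_elim
      case (elim n)
      have "?\<psi> n x = 0" if "x \<notin> box p q" for x
        using that elim by (auto simp: mem_box tensor_def intro!: plateau_eq_0)
      then have "?w x * ?\<psi> n x = indicator U x *\<^sub>R (v x * ?\<psi> n x)" for x
        using sub box_subset_cbox[of p q] by (cases "x \<in> box p q") (auto simp: indicator_def)
      then have "(LINT x|lebesgue. ?w x * ?\<psi> n x) = (LINT x:U|lebesgue. v x * ?\<psi> n x)"
        unfolding set_lebesgue_integral_def by (simp only:)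
      also have "\<dots> = 0" using elim by (intro test) auto
      finally show ?case .
    qed
  qed
  ultimately have "(LINT x|lebesgue. ?w x * indicator (box p q) x) = 0"
    by (intro tendsto_unique[OF sequentially_bot _ tendsto_eventually])
  moreover have "?w x * indicator (box p q) x = indicator (box p q) x *\<^sub>R v x" for x
    using box_subset_cbox[of p q] by (auto simp: indicator_def)
  ultimately show ?thesis unfolding set_lebesgue_integral_def by simp
qed

text \<open>Products of plateau functions are the only test functions that are needed. This matters later
  on, because integrals against them factor into one-dimensional integrals.\<close>

lemma fundamental_lemma:
  fixes v :: "'a::euclidean_space \<Rightarrow> real"
  assumes U: "open U"
    and v: "\<And>p q. cbox p q \<subseteq> U \<Longrightarrow> v absolutely_integrable_on cbox p q"
    and test: "\<And>p q n. cbox p q \<subseteq> U \<Longrightarrow> n > 0 \<Longrightarrow> (\<And>b. b \<in> Basis \<Longrightarrow> p \<bullet> b < q \<bullet> b) \<Longrightarrow>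
      (\<And>b. b \<in> Basis \<Longrightarrow> 1 \<le> n * (q \<bullet> b - p \<bullet> b)) \<Longrightarrow>
      (LINT x:U|lebesgue. v x * tensor (\<lambda>b. plateau (p \<bullet> b) (q \<bullet> b) n) x) = 0"
  shows "AE x in lebesgue. x \<in> U \<longrightarrow> v x = 0"
proof -
  have box0: "AE x in lebesgue. x \<in> cbox P Q \<longrightarrow> v x = 0" if PQ: "cbox P Q \<subseteq> U" for P Q
  proof -
    let ?w = "\<lambda>x. indicator (box P Q) x * v x"
    have "v absolutely_integrable_on box P Q"
      by (rule set_integrable_subset[OF v[OF PQ]]) (auto simp: box_subset_cbox)
    then have w: "integrable lebesgue ?w" by (simp add: set_integrable_def)
    have "(LINT x:box p q|lebesgue. ?w x) = 0" for p q
    proof -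
      \<comment> \<open>Cutting \<open>v\<close> off outside a fixed box makes it globally integrable and leaves only boxes contained in \<open>U\<close>.\<close>
      obtain r s where rs: "box p q \<inter> box P Q = box r s" using box_Int_box by blast
      have "(LINT x:box p q|lebesgue. ?w x) = (LINT x:box r s|lebesgue. v x)"
        unfolding set_lebesgue_integral_def rs[symmetric]
        by (intro Bochner_Integration.integral_cong) (auto simp: indicator_def)
      also have "\<dots> = 0"
      proof (cases "box r s = {}")
        case False
        have "closure (box r s) \<subseteq> cbox P Q"
          using rs box_subset_cbox[of P Q] by (intro closure_minimal) auto
        then have "cbox r s \<subseteq> cbox P Q" using False by (simp add: closure_box)
        then have "cbox r s \<subseteq> U" using PQ by blast
        then show ?thesis
          using False by (intro fundamental_lemma_box[of r s U] v test) (auto simp: box_ne_empty)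
      qed (simp add: set_lebesgue_integral_def)
      finally show ?thesis .
    qed
    from AE_eq_0_if_integral_boxes_eq_0[OF w this]
    have "AE x in lebesgue. ?w x = 0" .
    moreover have "AE x in lebesgue. x \<notin> cbox P Q - box P Q"
      using negligible_frontier_interval[of P Q]
      by (intro AE_not_in) (simp add: negligible_iff_null_sets)
    ultimately show ?thesis
      by eventually_elim (auto simp: indicator_def)
  qed
  obtain \<D> where D: "countable \<D>" "\<D> \<subseteq> Pow U" "\<And>X. X \<in> \<D> \<Longrightarrow> \<exists>a b. X = cbox a b" "\<Union>\<D> = U"
    by (rule open_countable_Union_open_cbox[OF U]) blast
  have "AE x in lebesgue. \<forall>X\<in>\<D>. x \<in> X \<longrightarrow> v x = 0"
  proof (subst AE_ball_countable[OF D(1)], intro ballI)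
    fix X
    assume X: "X \<in> \<D>"
    then obtain a b where "X = cbox a b" using D(3) by blast
    then show "AE x in lebesgue. x \<in> X \<longrightarrow> v x = 0" using box0[of a b] X D(2) by blast
  qed
  then show ?thesis by eventually_elim (use D in blast)
qed

section \<open>Weak partial derivatives\<close>

lemma absolutely_integrable_continuous_compact:
  fixes u :: "'a::euclidean_space \<Rightarrow> real"
  assumes "compact K" "continuous_on K u"
  shows "u absolutely_integrable_on K"
proof -
  have "integrable lborel (\<lambda>x. indicator K x *\<^sub>R u x)"
    by (rule borel_integrable_compact[OF assms])
  then show ?thesis
    unfolding set_integrable_def
    by (subst integrable_completion[OF borel_measurable_integrable])
qed

lemma integrable_continuous_compact_support:
  fixes u :: "'a::euclidean_space \<Rightarrow> real"
  assumes "compact K" "continuous_on UNIV u" "\<And>x. u x \<noteq> 0 \<Longrightarrow> x \<in> K"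
  shows "integrable lborel u"
proof -
  have "integrable lborel (\<lambda>x. indicator K x *\<^sub>R u x)"
    by (rule borel_integrable_compact[OF assms(1)]) (rule continuous_on_subset[OF assms(2)], simp)
  also have "(\<lambda>x. indicator K x *\<^sub>R u x) = u"
    using assms(3) by (auto simp: indicator_def fun_eq_iff)
  finally show ?thesis .
qed

lemma lborel_integral_translation:
  fixes u :: "'a::euclidean_space \<Rightarrow> real"
  assumes "integrable lborel u"
  shows "integrable lborel (\<lambda>x. u (c + x))" and "(LINT x|lborel. u (c + x)) = (LINT x|lborel. u x)"
proof -
  have m: "(+) c \<in> lborel \<rightarrow>\<^sub>M borel" by simp
  have u: "u \<in> borel_measurable borel"
    using borel_measurable_integrable[OF assms] by simp
  have "integrable (distr lborel borel ((+) c)) u"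
    unfolding lborel_distr_plus by (rule assms)
  then show "integrable lborel (\<lambda>x. u (c + x))"
    unfolding integrable_distr_eq[OF m u] .
  show "(LINT x|lborel. u (c + x)) = (LINT x|lborel. u x)"
    using integral_distr[OF m u] unfolding lborel_distr_plus by (rule sym)
qed

lemma derivative_eq_0_off_support:
  fixes \<eta> :: "'a::euclidean_space \<Rightarrow> real"
  assumes "(\<eta> has_derivative \<eta>') (at x)" "closed K" "x \<notin> K" "\<And>x. \<eta> x \<noteq> 0 \<Longrightarrow> x \<in> K"
  shows "\<eta>' = (\<lambda>_. 0)"
proof (rule has_derivative_unique[OF assms(1)])
  have "((\<lambda>_. 0) has_derivative (\<lambda>_. 0)) (at x)" by simp
  then show "(\<eta> has_derivative (\<lambda>_. 0)) (at x)"
    by (rule has_derivative_transform_within_open[where s = "- K"]) (use assms in \<open>auto simp: open_Compl\<close>)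
qed

text \<open>Integration by parts without boundary terms. The derivative is the limit of the difference
  quotients along \<open>b\<close>, whose integrals vanish because Lebesgue measure is invariant under
  translation; the mean value theorem and the compact support provide a dominating function.\<close>

lemma integral_directional_derivative_eq_0:
  fixes \<eta> :: "'a::euclidean_space \<Rightarrow> real"
  assumes d: "\<And>x. (\<eta> has_derivative \<eta>' x) (at x)"
    and cont: "continuous_on UNIV (\<lambda>x. \<eta>' x b)"
    and K: "compact K" and supp: "\<And>x. \<eta> x \<noteq> 0 \<Longrightarrow> x \<in> K"
  shows "integrable lebesgue (\<lambda>x. \<eta>' x b)" and "(LINT x|lebesgue. \<eta>' x b) = 0"
proof -
  have suppD: "x \<in> K" if "\<eta>' x b \<noteq> 0" for x
    using derivative_eq_0_off_support[OF d compact_imp_closed[OF K] _ supp, of x] that by force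
  have iD: "integrable lborel (\<lambda>x. \<eta>' x b)"
    by (rule integrable_continuous_compact_support[OF K cont suppD])
  have mD: "(\<lambda>x. \<eta>' x b) \<in> borel_measurable lborel"
    using iD by (rule borel_measurable_integrable)
  show "integrable lebesgue (\<lambda>x. \<eta>' x b)"
    using iD mD by (simp add: integrable_completion)
  have conte: "continuous_on UNIV \<eta>"
    using d by (auto intro!: continuous_at_imp_continuous_on has_derivative_continuous)
  have ie: "integrable lborel \<eta>"
    by (rule integrable_continuous_compact_support[OF K conte supp])
  obtain M where M: "\<And>x. x \<in> K \<Longrightarrow> \<bar>\<eta>' x b\<bar> \<le> M"
    using compact_imp_bounded[OF compact_continuous_image[OF continuous_on_subset[OF cont subset_UNIV] K]]
    by (auto simp: bounded_iff)
  obtain R where R: "\<And>x. x \<in> K \<Longrightarrow> norm x \<le> R"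
    using compact_imp_bounded[OF K] by (auto simp: bounded_iff)
  \<comment> \<open>If \<open>K\<close> is empty then \<open>M\<close> may be negative.\<close>
  define C where "C = max M 0"
  have C: "\<bar>\<eta>' x b\<bar> \<le> C" for x
    using M[of x] suppD[of x] by (cases "\<eta>' x b = 0") (auto simp: C_def)
  define q where "q n x = real (Suc n) * (\<eta> ((1 / real (Suc n)) *\<^sub>R b + x) - \<eta> x)" for n x
  have line: "((\<lambda>t. \<eta> (t *\<^sub>R b + x)) has_real_derivative \<eta>' (t *\<^sub>R b + x) b) (at t)" for x t
  proof -
    have "((\<lambda>t. \<eta> (t *\<^sub>R b + x)) has_derivative (\<lambda>h. \<eta>' (t *\<^sub>R b + x) (h *\<^sub>R b))) (at t)"
      by (rule has_derivative_compose[where f = "\<lambda>t. t *\<^sub>R b + x" and f' = "\<lambda>h. h *\<^sub>R b"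
            and g' = "\<eta>' (t *\<^sub>R b + x)"]) (auto intro!: derivative_eq_intros d)
    moreover have "linear (\<eta>' (t *\<^sub>R b + x))" using d has_derivative_linear by blast
    ultimately show ?thesis
      by (simp add: has_field_derivative_def linear_cmul mult.commute[of _ "\<eta>' (t *\<^sub>R b + x) b"])
  qed
  have lim: "(\<lambda>n. q n x) \<longlonglongrightarrow> \<eta>' x b" for x
  proof -
    have "((\<lambda>t. (\<eta> (t *\<^sub>R b + x) - \<eta> x) / t) \<longlongrightarrow> \<eta>' x b) (at 0)"
      using line[of x 0] by (simp add: has_field_derivative_iff)
    moreover have "filterlim (\<lambda>n. 1 / real (Suc n)) (at 0) sequentially"
      using LIMSEQ_Suc[OF lim_1_over_n[where 'a = real]] by (simp add: filterlim_at)
    ultimately have "(\<lambda>n. (\<eta> ((1 / real (Suc n)) *\<^sub>R b + x) - \<eta> x) / (1 / real (Suc n))) \<longlonglongrightarrow> \<eta>' x b"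
      by (rule filterlim_compose)
    then show ?thesis by (simp add: q_def mult.commute)
  qed
  have bound: "\<bar>q n x\<bar> \<le> C * indicator (cball 0 (R + norm b)) x" for n x
  proof (cases "x \<in> cball 0 (R + norm b)")
    case True
    have pos: "0 < 1 / real (Suc n)" by simp
    obtain z where "\<eta> ((1 / real (Suc n)) *\<^sub>R b + x) - \<eta> (0 *\<^sub>R b + x)
        = (1 / real (Suc n) - 0) * \<eta>' (z *\<^sub>R b + x) b"
      using MVT2[OF pos, of "\<lambda>t. \<eta> (t *\<^sub>R b + x)" "\<lambda>t. \<eta>' (t *\<^sub>R b + x) b"] line by blast
    then have "q n x = \<eta>' (z *\<^sub>R b + x) b" by (simp add: q_def)
    then show ?thesis using True C by simp
  next
    case False
    have "x \<notin> K" using False R[of x] norm_ge_zero[of b] by force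
    moreover have "(1 / real (Suc n)) *\<^sub>R b + x \<notin> K"
    proof
      assume "(1 / real (Suc n)) *\<^sub>R b + x \<in> K"
      then have "norm ((1 / real (Suc n)) *\<^sub>R b + x) \<le> R" by (rule R)
      moreover have "norm x \<le> norm ((1 / real (Suc n)) *\<^sub>R b + x) + norm ((1 / real (Suc n)) *\<^sub>R b)"
        using norm_triangle_ineq4[of "(1 / real (Suc n)) *\<^sub>R b + x" "(1 / real (Suc n)) *\<^sub>R b"] by simp
      moreover have "norm ((1 / real (Suc n)) *\<^sub>R b) \<le> norm b"
        using mult_right_mono[of "1 / real (Suc n)" 1 "norm b"] by simp
      ultimately show False using False by simp
    qed
    ultimately have "\<eta> x = 0" "\<eta> ((1 / real (Suc n)) *\<^sub>R b + x) = 0"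
      using supp by blast+
    then have "q n x = 0" unfolding q_def by simp
    then show ?thesis using False by simp
  qed
  have "(\<lambda>n. LINT x|lborel. q n x) \<longlonglongrightarrow> (LINT x|lborel. \<eta>' x b)"
  proof (rule integral_dominated_convergence[where w = "\<lambda>x. C * indicator (cball 0 (R + norm b)) x"])
    have [measurable]: "\<eta> \<in> borel_measurable borel" using ie by auto
    show "q n \<in> borel_measurable lborel" for n unfolding q_def[abs_def] by measurable
    show "integrable lborel (\<lambda>x::'a. C * indicator (cball 0 (R + norm b)) x)"
      by (intro integrable_mult_right integrable_real_indicator emeasure_bounded_finite bounded_cball) simp
  qed (use lim bound mD in auto)
  moreover have "(LINT x|lborel. q n x) = 0" for n
    unfolding q_def using lborel_integral_translation[OF ie] ie by simp
  ultimately have "(LINT x|lborel. \<eta>' x b) = 0" by (simp add: LIMSEQ_const_iff)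
  then show "(LINT x|lebesgue. \<eta>' x b) = 0" using mD by (simp add: integral_completion)
qed

lemma test_functionE:
  assumes "\<psi> \<in> test_functions U"
  obtains K where "smooth \<psi>" "compact K" "K \<subseteq> U" "\<And>x. \<psi> x \<noteq> 0 \<Longrightarrow> x \<in> K"
    "\<And>x b. frechet_derivative \<psi> (at x) b \<noteq> 0 \<Longrightarrow> x \<in> K"
proof -
  let ?K = "closure {x. \<psi> x \<noteq> 0}"
  have s: "smooth \<psi>" and K: "compact ?K" "?K \<subseteq> U"
    using assms by (auto simp: test_functions_def smooth_def)
  have supp: "x \<in> ?K" if "\<psi> x \<noteq> 0" for x using that closure_subset[of "{x. \<psi> x \<noteq> 0}"] by blast
  have "x \<in> ?K" if "frechet_derivative \<psi> (at x) b \<noteq> 0" for x b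
    using derivative_eq_0_off_support[OF smooth_has_derivative[OF s] compact_imp_closed[OF K(1)] _ supp, of x]
      that by force
  with s K supp show ?thesis using that by blast
qed

lemma set_integrable_times_compact_support:
  fixes w g :: "'a::euclidean_space \<Rightarrow> real"
  assumes w: "w locally_integrable_on U" and g: "continuous_on UNIV g"
    and K: "compact K" "K \<subseteq> U" and supp: "\<And>x. g x \<noteq> 0 \<Longrightarrow> x \<in> K"
  shows "set_integrable lebesgue U (\<lambda>x. w x * g x)"
proof -
  have KL: "K \<in> sets lebesgue" using K(1) by (simp add: borel_compact)
  have gK: "continuous_on K g" using g by (rule continuous_on_subset) simp
  have "(\<lambda>x. g x * w x) absolutely_integrable_on K"
  proof (rule absolutely_integrable_bounded_measurable_product[OF bilinear_times])
    show "g \<in> borel_measurable (lebesgue_on K)"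
      by (rule continuous_imp_measurable_on_sets_lebesgue[OF gK KL])
    show "bounded (g ` K)" using compact_continuous_image[OF gK K(1)] by (rule compact_imp_bounded)
    show "w absolutely_integrable_on K" using w K by (auto simp: locally_integrable_on_def)
  qed (rule KL)
  moreover have "indicator K x *\<^sub>R (g x * w x) = indicator U x *\<^sub>R (w x * g x)" for x
    using K supp by (auto simp: indicator_def)
  ultimately show ?thesis by (simp only: set_integrable_def)
qed

lemma set_integrable_times_test_function:
  fixes w :: "'a::euclidean_space \<Rightarrow> real"
  assumes "w locally_integrable_on U" "\<psi> \<in> test_functions U"
  shows "set_integrable lebesgue U (\<lambda>x. w x * \<psi> x)"
    and "b \<in> Basis \<Longrightarrow> set_integrable lebesgue U (\<lambda>x. w x * frechet_derivative \<psi> (at x) b)"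
proof -
  obtain K where K: "smooth \<psi>" "compact K" "K \<subseteq> U" "\<And>x. \<psi> x \<noteq> 0 \<Longrightarrow> x \<in> K"
      "\<And>x b. frechet_derivative \<psi> (at x) b \<noteq> 0 \<Longrightarrow> x \<in> K"
    using test_functionE[OF assms(2)] by blast
  show "set_integrable lebesgue U (\<lambda>x. w x * \<psi> x)"
    by (rule set_integrable_times_compact_support[OF assms(1) smooth_continuous[OF K(1)] K(2-4)])
  show "set_integrable lebesgue U (\<lambda>x. w x * frechet_derivative \<psi> (at x) b)" if "b \<in> Basis"
    by (rule set_integrable_times_compact_support[OF assms(1)
          smooth_continuous[OF smooth_frechet_derivative[OF K(1) that]] K(2,3,5)])
qed

lemma locally_integrable_on_add:
  "u locally_integrable_on U \<Longrightarrow> v locally_integrable_on U \<Longrightarrow> (\<lambda>x. u x + v x) locally_integrable_on U"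
  by (auto simp: locally_integrable_on_def intro: set_integral_add)

lemma continuous_imp_locally_integrable_on:
  "continuous_on U u \<Longrightarrow> u locally_integrable_on U"
  unfolding locally_integrable_on_def
  by (intro allI impI absolutely_integrable_continuous_compact) (auto intro: continuous_on_subset)

lemma locally_integrable_on_cong:
  assumes "u locally_integrable_on U" "\<And>x. x \<in> U \<Longrightarrow> u x = u' x"
  shows "u' locally_integrable_on U"
  unfolding locally_integrable_on_def
proof (intro allI impI)
  fix K
  assume K: "compact K \<and> K \<subseteq> U"
  then have "u absolutely_integrable_on K" using assms(1) by (simp add: locally_integrable_on_def)
  moreover have "indicator K x *\<^sub>R u x = indicator K x *\<^sub>R u' x" for x
    using K assms(2)[of x] by (auto simp: indicator_def)
  ultimately show "u' absolutely_integrable_on K" by (simp only: set_integrable_def)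
qed

lemma weak_partial_deriv_cong:
  assumes w: "weak_partial_deriv U b u v"
    and eq: "\<And>x. x \<in> U \<Longrightarrow> u x = u' x" "\<And>x. x \<in> U \<Longrightarrow> v x = v' x"
  shows "weak_partial_deriv U b u' v'"
proof -
  have "(LINT x:U|lebesgue. u' x * g x) = (LINT x:U|lebesgue. u x * g x)"
    "(LINT x:U|lebesgue. v' x * g x) = (LINT x:U|lebesgue. v x * g x)" for g
    unfolding set_lebesgue_integral_def
    by (intro Bochner_Integration.integral_cong; simp add: eq indicator_def)+
  then show ?thesis
    using w eq by (auto simp: weak_partial_deriv_def intro: locally_integrable_on_cong)
qed

lemma weak_partial_deriv_add:
  assumes "weak_partial_deriv U b u v" "weak_partial_deriv U b u' v'" "b \<in> Basis"
  shows "weak_partial_deriv U b (\<lambda>x. u x + u' x) (\<lambda>x. v x + v' x)"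
  unfolding weak_partial_deriv_def
proof (intro conjI ballI)
  have u: "u locally_integrable_on U" "u' locally_integrable_on U"
    and v: "v locally_integrable_on U" "v' locally_integrable_on U"
    using assms by (auto simp: weak_partial_deriv_def)
  show "(\<lambda>x. u x + u' x) locally_integrable_on U" "(\<lambda>x. v x + v' x) locally_integrable_on U"
    by (intro locally_integrable_on_add u v)+
  fix \<psi>
  assume t: "\<psi> \<in> test_functions U"
  let ?D = "\<lambda>x. frechet_derivative \<psi> (at x) b"
  have "(LINT x:U|lebesgue. u x * ?D x + u' x * ?D x)
      = (LINT x:U|lebesgue. u x * ?D x) + (LINT x:U|lebesgue. u' x * ?D x)"
    by (intro set_integral_add set_integrable_times_test_function u t assms)
  also have "\<dots> = - ((LINT x:U|lebesgue. v x * \<psi> x) + (LINT x:U|lebesgue. v' x * \<psi> x))"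
    using assms t by (simp add: weak_partial_deriv_def)
  also have "(LINT x:U|lebesgue. v x * \<psi> x) + (LINT x:U|lebesgue. v' x * \<psi> x)
      = (LINT x:U|lebesgue. v x * \<psi> x + v' x * \<psi> x)"
    by (intro set_integral_add(2)[symmetric] set_integrable_times_test_function v t)
  finally show "(LINT x:U|lebesgue. (u x + u' x) * ?D x)
      = - (LINT x:U|lebesgue. (v x + v' x) * \<psi> x)"
    by (simp only: distrib_right)
qed

text \<open>Linear functions have their classical derivatives as weak ones: apply
  \<open>integral_directional_derivative_eq_0\<close> to the product of the linear function with the test function.\<close>

lemma weak_partial_deriv_inner:
  fixes b w :: "'a::euclidean_space"
  assumes b: "b \<in> Basis"
  shows "weak_partial_deriv U b (\<lambda>x. x \<bullet> w) (\<lambda>x. b \<bullet> w)"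
  unfolding weak_partial_deriv_def
proof (intro conjI ballI)
  show l: "(\<lambda>x. x \<bullet> w) locally_integrable_on U" "(\<lambda>x. b \<bullet> w) locally_integrable_on U"
    by (auto intro!: continuous_imp_locally_integrable_on continuous_intros)
  fix \<psi>
  assume t: "\<psi> \<in> test_functions U"
  obtain K where K: "smooth \<psi>" "compact K" "K \<subseteq> U" "\<And>x. \<psi> x \<noteq> 0 \<Longrightarrow> x \<in> K"
      "\<And>x b. frechet_derivative \<psi> (at x) b \<noteq> 0 \<Longrightarrow> x \<in> K"
    using test_functionE[OF t] by blast
  let ?D = "\<lambda>x. frechet_derivative \<psi> (at x)"
  let ?D' = "\<lambda>x h. (x \<bullet> w) * ?D x h + (h \<bullet> w) * \<psi> x"
  have "(LINT x|lebesgue. ?D' x b) = 0"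
  proof (rule integral_directional_derivative_eq_0(2)[where \<eta> = "\<lambda>x. (x \<bullet> w) * \<psi> x" and \<eta>' = ?D', OF _ _ K(2)])
    show "((\<lambda>x. (x \<bullet> w) * \<psi> x) has_derivative ?D' x) (at x)" for x
      by (intro has_derivative_mult smooth_has_derivative K has_derivative_inner_left has_derivative_ident)
    show "continuous_on UNIV (\<lambda>x. ?D' x b)"
      by (intro continuous_intros smooth_continuous smooth_frechet_derivative K b)
  qed (use K(4) in auto)
  also have "(LINT x|lebesgue. ?D' x b) = (LINT x:U|lebesgue. (x \<bullet> w) * ?D x b + (b \<bullet> w) * \<psi> x)"
    unfolding set_lebesgue_integral_def
  proof (rule Bochner_Integration.integral_cong)
    fix x
    show "?D' x b = indicator U x *\<^sub>R ((x \<bullet> w) * ?D x b + (b \<bullet> w) * \<psi> x)"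
    proof (cases "x \<in> U")
      case False
      then have "\<psi> x = 0" "?D x b = 0" using K(3) K(4)[of x] K(5)[of x b] by blast+
      then show ?thesis by simp
    qed simp
  qed simp
  also have "\<dots> = (LINT x:U|lebesgue. (x \<bullet> w) * ?D x b) + (LINT x:U|lebesgue. (b \<bullet> w) * \<psi> x)"
    by (intro set_integral_add set_integrable_times_test_function l t b)
  finally show "(LINT x:U|lebesgue. (x \<bullet> w) * ?D x b) = - (LINT x:U|lebesgue. (b \<bullet> w) * \<psi> x)"
    by simp
qed

lemma tensor_plateau_in_test_functions:
  assumes "cbox p q \<subseteq> U" "n > 0" "\<And>b. b \<in> Basis \<Longrightarrow> 1 \<le> n * (q \<bullet> b - p \<bullet> b)"
  shows "tensor (\<lambda>b. plateau (p \<bullet> b) (q \<bullet> b) n) \<in> test_functions U"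
proof (rule tensor_in_test_functions[OF smooth_plateau assms(1)])
  fix b :: 'a and t
  assume "b \<in> Basis" "plateau (p \<bullet> b) (q \<bullet> b) n t \<noteq> 0"
  then have "t \<in> {p \<bullet> b<..<q \<bullet> b}" using plateau_eq_0 assms by blast
  then show "p \<bullet> b \<le> t \<and> t \<le> q \<bullet> b" by simp
qed

lemma weak_partial_deriv_unique:
  fixes U :: "'a::euclidean_space set"
  assumes "open U" and v: "weak_partial_deriv U b u v" and v': "weak_partial_deriv U b u v'"
  shows "AE x in lebesgue. x \<in> U \<longrightarrow> v x = v' x"
proof -
  have "AE x in lebesgue. x \<in> U \<longrightarrow> v x - v' x = 0"
  proof (rule fundamental_lemma[OF assms(1)])
    show "(\<lambda>x. v x - v' x) absolutely_integrable_on cbox p q" if "cbox p q \<subseteq> U" for p q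
      using v v' that by (auto simp: weak_partial_deriv_def locally_integrable_on_def intro!: set_integral_diff)
    fix p q :: 'a and n :: real
    assume "cbox p q \<subseteq> U" "n > 0" "\<And>b. b \<in> Basis \<Longrightarrow> 1 \<le> n * (q \<bullet> b - p \<bullet> b)"
    then have t: "tensor (\<lambda>b. plateau (p \<bullet> b) (q \<bullet> b) n) \<in> test_functions U" (is "?\<psi> \<in> _")
      by (rule tensor_plateau_in_test_functions)
    have "(LINT x:U|lebesgue. v x * ?\<psi> x - v' x * ?\<psi> x)
        = (LINT x:U|lebesgue. v x * ?\<psi> x) - (LINT x:U|lebesgue. v' x * ?\<psi> x)"
      using v v' t by (intro set_integral_diff set_integrable_times_test_function) (auto simp: weak_partial_deriv_def)
    also have "(LINT x:U|lebesgue. v x * ?\<psi> x) = (LINT x:U|lebesgue. v' x * ?\<psi> x)"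
      using v v' t unfolding weak_partial_deriv_def by simp
    finally show "(LINT x:U|lebesgue. (v x - v' x) * ?\<psi> x) = 0"
      by (simp add: left_diff_distrib)
  qed
  then show ?thesis by simp
qed

section \<open>Functions of a single coordinate\<close>

text \<open>Multiplying a tensor product by a function of the coordinate \<open>x \<bullet> k\<close> only changes the factor
  belonging to \<open>k\<close>, so the integral still factors. The function \<open>F\<close> is known on an open interval
  only, which is why the factor for \<open>k\<close> is integrated over that interval.\<close>

lemma cylinder_integral:
  fixes \<beta> :: "'a::euclidean_space \<Rightarrow> real \<Rightarrow> real"
  assumes k: "k \<in> Basis"
    and supp: "\<And>x. x \<notin> box l r \<Longrightarrow> tensor \<beta> x = 0"
    and ik: "set_integrable lebesgue {l \<bullet> k<..<r \<bullet> k} (\<lambda>t. F t * \<beta> k t)"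
    and ib: "\<And>b. b \<in> Basis \<Longrightarrow> b \<noteq> k \<Longrightarrow> integrable lebesgue (\<beta> b)"
  shows "set_integrable lebesgue (box l r) (\<lambda>x. F (x \<bullet> k) * tensor \<beta> x)"
    and "(LINT x:box l r|lebesgue. F (x \<bullet> k) * tensor \<beta> x)
      = (LINT t:{l \<bullet> k<..<r \<bullet> k}|lebesgue. F t * \<beta> k t) * (\<Prod>b\<in>Basis - {k}. LINT t|lebesgue. \<beta> b t)"
proof -
  define h where "h = \<beta>(k := \<lambda>t. indicator {l \<bullet> k<..<r \<bullet> k} t *\<^sub>R (F t * \<beta> k t))"
  have ih: "integrable lebesgue (h b)" if "b \<in> Basis" for b
    using that ik ib by (auto simp: h_def set_integrable_def)
  have h: "tensor h x = indicator (box l r) x *\<^sub>R (F (x \<bullet> k) * tensor \<beta> x)" for x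
  proof -
    have "tensor \<beta> x = \<beta> k (x \<bullet> k) * (\<Prod>b\<in>Basis - {k}. \<beta> b (x \<bullet> b))"
      using tensor_fun_upd[OF k, of \<beta> "\<beta> k"] by simp
    moreover have "tensor h x = indicator {l \<bullet> k<..<r \<bullet> k} (x \<bullet> k) *\<^sub>R (F (x \<bullet> k) * \<beta> k (x \<bullet> k))
        * (\<Prod>b\<in>Basis - {k}. \<beta> b (x \<bullet> b))"
      unfolding h_def by (rule tensor_fun_upd[OF k])
    ultimately have "tensor h x = indicator {l \<bullet> k<..<r \<bullet> k} (x \<bullet> k) * (F (x \<bullet> k) * tensor \<beta> x)"
      by simp
    moreover have "x \<in> box l r \<Longrightarrow> x \<bullet> k \<in> {l \<bullet> k<..<r \<bullet> k}" using k by (simp add: mem_box)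
    ultimately show ?thesis using supp[of x] by (cases "x \<in> box l r") auto
  qed
  show "set_integrable lebesgue (box l r) (\<lambda>x. F (x \<bullet> k) * tensor \<beta> x)"
    unfolding set_integrable_def h[symmetric] by (rule tensor_integral(1)[OF ih])
  have "(LINT x:box l r|lebesgue. F (x \<bullet> k) * tensor \<beta> x) = (\<Prod>b\<in>Basis. LINT t|lebesgue. h b t)"
    unfolding set_lebesgue_integral_def h[symmetric] by (rule tensor_integral(2)[OF ih])
  also have "\<dots> = (LINT t|lebesgue. h k t) * (\<Prod>b\<in>Basis - {k}. LINT t|lebesgue. h b t)"
    using k by (simp add: prod.remove)
  also have "(LINT t|lebesgue. h k t) = (LINT t:{l \<bullet> k<..<r \<bullet> k}|lebesgue. F t * \<beta> k t)"
    by (simp add: h_def set_lebesgue_integral_def)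
  also have "(\<Prod>b\<in>Basis - {k}. LINT t|lebesgue. h b t) = (\<Prod>b\<in>Basis - {k}. LINT t|lebesgue. \<beta> b t)"
    by (intro prod.cong) (auto simp: h_def)
  finally show "(LINT x:box l r|lebesgue. F (x \<bullet> k) * tensor \<beta> x)
      = (LINT t:{l \<bullet> k<..<r \<bullet> k}|lebesgue. F t * \<beta> k t) * (\<Prod>b\<in>Basis - {k}. LINT t|lebesgue. \<beta> b t)" .
qed

lemma integrable_lebesgue_plateau:
  assumes "n > 0" "1 \<le> n * (u - l)"
  shows "integrable lebesgue (plateau l u n)" "integrable lebesgue (deriv (plateau l u n))"
    and "(LINT t|lebesgue. deriv (plateau l u n) t) = 0"
proof -
  have s: "t \<in> {l..u}" if "plateau l u n t \<noteq> 0" for t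
    using plateau_eq_0[OF assms, of t] that by fastforce
  have "integrable lborel (plateau l u n)"
    by (rule integrable_continuous_compact_support[OF compact_Icc smooth_continuous[OF smooth_plateau] s])
  then show "integrable lebesgue (plateau l u n)"
    by (subst integrable_completion[OF borel_measurable_integrable])
  have d: "(plateau l u n has_derivative (*) (deriv (plateau l u n) t)) (at t)" for t
    using smooth_DERIV(1)[OF smooth_plateau] by (simp add: has_field_derivative_def)
  have "continuous_on UNIV (\<lambda>t. deriv (plateau l u n) t * 1)"
    using smooth_continuous[OF smooth_deriv[OF smooth_plateau]] by simp
  from integral_directional_derivative_eq_0[of "plateau l u n" "\<lambda>t h. deriv (plateau l u n) t * h" 1, OF d this compact_Icc s]
  show "integrable lebesgue (deriv (plateau l u n))" "(LINT t|lebesgue. deriv (plateau l u n) t) = 0"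
    by simp_all
qed

text \<open>The case of \<open>cylinder_integral\<close> in which all factors are indicators of compact intervals.\<close>

lemma absolutely_integrable_cylinder:
  fixes l r :: "'a::euclidean_space"
  assumes k: "k \<in> Basis" and F: "F locally_integrable_on {l \<bullet> k<..<r \<bullet> k}"
    and sub: "cbox p q \<subseteq> box l r"
  shows "(\<lambda>x. F (x \<bullet> k)) absolutely_integrable_on cbox p q"
proof (cases "cbox p q = {}")
  case False
  then have "p \<in> cbox p q" "q \<in> cbox p q" by (auto simp: box_ne_empty mem_box)
  then have "p \<in> box l r" "q \<in> box l r" using sub by blast+
  then have "l \<bullet> k < p \<bullet> k" "q \<bullet> k < r \<bullet> k" using k by (simp_all add: mem_box)
  then have s: "{p \<bullet> k..q \<bullet> k} \<subseteq> {l \<bullet> k<..<r \<bullet> k}" by auto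
  define \<beta> where "\<beta> b = (indicator {p \<bullet> b..q \<bullet> b} :: real \<Rightarrow> real)" for b
  have t: "tensor \<beta> x = indicator (cbox p q) x" for x
    by (auto simp: tensor_def \<beta>_def indicator_def mem_box)
  have "F absolutely_integrable_on {p \<bullet> k..q \<bullet> k}"
    using F s by (simp add: locally_integrable_on_def)
  moreover have "indicator {p \<bullet> k..q \<bullet> k} t *\<^sub>R F t = indicator {l \<bullet> k<..<r \<bullet> k} t *\<^sub>R (F t * \<beta> k t)" for t
    using s by (auto simp: \<beta>_def indicator_def)
  ultimately have "set_integrable lebesgue {l \<bullet> k<..<r \<bullet> k} (\<lambda>t. F t * \<beta> k t)"
    by (simp only: set_integrable_def)
  moreover have "integrable lebesgue (\<beta> b)" for b
    unfolding \<beta>_def by (intro integrable_real_indicator) (auto simp: emeasure_lborel_Icc_eq)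
  moreover have "tensor \<beta> x = 0" if "x \<notin> box l r" for x
    using that sub by (auto simp: t indicator_def)
  ultimately have "set_integrable lebesgue (box l r) (\<lambda>x. F (x \<bullet> k) * tensor \<beta> x)"
    by (intro cylinder_integral(1)[OF k])
  moreover have "indicator (box l r) x *\<^sub>R (F (x \<bullet> k) * tensor \<beta> x) = indicator (cbox p q) x *\<^sub>R F (x \<bullet> k)" for x
    using sub by (auto simp: t indicator_def)
  ultimately show ?thesis by (simp only: set_integrable_def)
qed (simp add: set_integrable_def)

text \<open>Testing with a product of plateau functions and integrating coordinate by coordinate reduces
  the claim to one dimension. For \<open>j = k\<close> the factor belonging to \<open>k\<close> is the defining equation of the
  weak derivative \<open>f'\<close>; for \<open>j \<noteq> k\<close> the factor belonging to \<open>j\<close> is the integral of the derivative of a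
  plateau function, which is zero.\<close>

lemma weak_partial_deriv_cylinder:
  fixes l r :: "'a::euclidean_space"
  assumes k: "k \<in> Basis" and j: "j \<in> Basis"
    and f: "weak_partial_deriv {l \<bullet> k<..<r \<bullet> k} 1 f f'"
    and v: "weak_partial_deriv (box l r) j (\<lambda>x. f (x \<bullet> k)) v"
  shows "AE x in lebesgue. x \<in> box l r \<longrightarrow> v x = (if j = k then f' (x \<bullet> k) else 0)"
proof -
  let ?I = "{l \<bullet> k<..<r \<bullet> k}"
  define g where "g x = (if j = k then f' (x \<bullet> k) else 0)" for x
  have lf: "f locally_integrable_on ?I" "f' locally_integrable_on ?I"
    and lv: "v locally_integrable_on box l r"
    using f v by (auto simp: weak_partial_deriv_def)
  have ig: "g absolutely_integrable_on cbox p q" if "cbox p q \<subseteq> box l r" for p q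
    using absolutely_integrable_cylinder[OF k lf(2) that]
    by (cases "j = k") (simp_all add: g_def[abs_def] set_integrable_def)
  have "AE x in lebesgue. x \<in> box l r \<longrightarrow> v x - g x = 0"
  proof (rule fundamental_lemma[OF open_box])
    show "(\<lambda>x. v x - g x) absolutely_integrable_on cbox p q" if "cbox p q \<subseteq> box l r" for p q
      using lv ig[OF that] that by (auto simp: locally_integrable_on_def intro!: set_integral_diff)
    fix p q :: 'a and n :: real
    assume sub: "cbox p q \<subseteq> box l r" and n: "n > 0" and lt: "\<And>b. b \<in> Basis \<Longrightarrow> p \<bullet> b < q \<bullet> b"
      and big: "\<And>b. b \<in> Basis \<Longrightarrow> 1 \<le> n * (q \<bullet> b - p \<bullet> b)"
    define \<alpha> where "\<alpha> b = plateau (p \<bullet> b) (q \<bullet> b) n" for b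
    define \<alpha>' where "\<alpha>' = \<alpha>(j := deriv (\<alpha> j))"
    have sm: "smooth (\<alpha> b)" for b by (simp add: \<alpha>_def smooth_plateau)
    have t: "tensor \<alpha> \<in> test_functions (box l r)"
      unfolding \<alpha>_def[abs_def] by (rule tensor_plateau_in_test_functions[OF sub n big])
    have supp: "\<alpha> b t = 0" "\<alpha>' b t = 0" if "b \<in> Basis" "t \<notin> {p \<bullet> b<..<q \<bullet> b}" for b t
      using plateau_eq_0[OF n big[OF that(1)] that(2)] deriv_plateau_eq_0[OF n big[OF that(1)] that(2)]
      by (auto simp: \<alpha>_def \<alpha>'_def)
    have tsupp: "tensor \<alpha> x = 0" "tensor \<alpha>' x = 0" if x: "x \<notin> box l r" for x
    proof -
      from x sub box_subset_cbox have "x \<notin> box p q" by blast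
      then obtain b where "b \<in> Basis" "x \<bullet> b \<notin> {p \<bullet> b<..<q \<bullet> b}" by (auto simp: mem_box)
      then show "tensor \<alpha> x = 0" "tensor \<alpha>' x = 0"
        using supp[of b "x \<bullet> b"] by (auto simp: tensor_def)
    qed
    have int: "integrable lebesgue (\<alpha> b)" "integrable lebesgue (\<alpha>' b)" if "b \<in> Basis" for b
      using integrable_lebesgue_plateau[OF n big[OF that]] by (auto simp: \<alpha>_def \<alpha>'_def)
    have "p \<in> cbox p q" "q \<in> cbox p q" using lt by (auto simp: mem_box less_imp_le)
    then have "p \<in> box l r" "q \<in> box l r" using sub by blast+
    then have "l \<bullet> k < p \<bullet> k" "q \<bullet> k < r \<bullet> k" using k by (simp_all add: mem_box)
    then have Isub: "{p \<bullet> k..q \<bullet> k} \<subseteq> ?I" by auto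
    have tk: "\<alpha> k \<in> test_functions ?I"
    proof (rule test_functionsI[OF sm compact_Icc Isub])
      show "t \<in> {p \<bullet> k..q \<bullet> k}" if "\<alpha> k t \<noteq> 0" for t
        using supp(1)[OF k, of t] that by (cases "t \<in> {p \<bullet> k<..<q \<bullet> k}") auto
    qed
    have fd: "frechet_derivative (\<alpha> k) (at t) 1 = deriv (\<alpha> k) t" for t
      by (rule smooth_DERIV(2)[OF sm])
    have ifk: "set_integrable lebesgue ?I (\<lambda>t. f t * \<alpha> k t)"
        "set_integrable lebesgue ?I (\<lambda>t. f' t * \<alpha> k t)"
        "set_integrable lebesgue ?I (\<lambda>t. f t * deriv (\<alpha> k) t)"
      using set_integrable_times_test_function(1)[OF lf(1) tk] set_integrable_times_test_function(1)[OF lf(2) tk]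
        set_integrable_times_test_function(2)[OF lf(1) tk, of 1] by (simp_all add: fd)
    have "(LINT x:box l r|lebesgue. v x * tensor \<alpha> x)
        = - (LINT x:box l r|lebesgue. f (x \<bullet> k) * frechet_derivative (tensor \<alpha>) (at x) j)"
      using v t by (simp add: weak_partial_deriv_def)
    also have "(\<lambda>x. f (x \<bullet> k) * frechet_derivative (tensor \<alpha>) (at x) j) = (\<lambda>x. f (x \<bullet> k) * tensor \<alpha>' x)"
      unfolding \<alpha>'_def by (simp only: frechet_derivative_tensor[OF sm j])
    also have "(LINT x:box l r|lebesgue. f (x \<bullet> k) * tensor \<alpha>' x)
      = (LINT t:?I|lebesgue. f t * \<alpha>' k t) * (\<Prod>b\<in>Basis - {k}. LINT t|lebesgue. \<alpha>' b t)"
      by (rule cylinder_integral(2)[OF k tsupp(2) _ int(2)]) (use ifk in \<open>auto simp: \<alpha>'_def\<close>)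
    also have "- \<dots> = (LINT x:box l r|lebesgue. g x * tensor \<alpha> x)"
    proof (cases "j = k")
      case True
      have "(LINT t:?I|lebesgue. f t * \<alpha>' k t) = - (LINT t:?I|lebesgue. f' t * \<alpha> k t)"
        using f tk by (simp add: weak_partial_deriv_def fd[symmetric] \<alpha>'_def True)
      moreover have "(\<Prod>b\<in>Basis - {k}. LINT t|lebesgue. \<alpha>' b t) = (\<Prod>b\<in>Basis - {k}. LINT t|lebesgue. \<alpha> b t)"
        by (intro prod.cong) (auto simp: \<alpha>'_def True)
      moreover have "(LINT x:box l r|lebesgue. f' (x \<bullet> k) * tensor \<alpha> x)
        = (LINT t:?I|lebesgue. f' t * \<alpha> k t) * (\<Prod>b\<in>Basis - {k}. LINT t|lebesgue. \<alpha> b t)"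
        by (rule cylinder_integral(2)[OF k tsupp(1) ifk(2) int(1)])
      ultimately show ?thesis by (simp add: g_def True)
    next
      case False
      have "(LINT t|lebesgue. \<alpha>' j t) = 0"
        using integrable_lebesgue_plateau(3)[OF n big[OF j]] by (simp add: \<alpha>'_def \<alpha>_def)
      then have "(\<Prod>b\<in>Basis - {k}. LINT t|lebesgue. \<alpha>' b t) = 0"
        using j False by (intro prod_zero) auto
      then show ?thesis using False by (simp add: g_def set_lebesgue_integral_def)
    qed
    finally have eq: "(LINT x:box l r|lebesgue. v x * tensor \<alpha> x) = (LINT x:box l r|lebesgue. g x * tensor \<alpha> x)" .
    have "set_integrable lebesgue (box l r) (\<lambda>x. g x * tensor \<alpha> x)"
      using cylinder_integral(1)[OF k tsupp(1) ifk(2) int(1)]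
      by (cases "j = k") (auto simp: g_def set_integrable_def)
    then have "(LINT x:box l r|lebesgue. v x * tensor \<alpha> x - g x * tensor \<alpha> x) = 0"
      using set_integrable_times_test_function(1)[OF lv t] eq by (simp add: set_integral_diff)
    then show "(LINT x:box l r|lebesgue. (v x - g x) * tensor (\<lambda>b. plateau (p \<bullet> b) (q \<bullet> b) n) x) = 0"
      unfolding \<alpha>_def[abs_def] by (simp only: left_diff_distrib)
  qed
  then show ?thesis by (simp add: g_def)
qed

text \<open>Each of the two unit masses making up the derivative of the plateau function is rescaled to the
  fixed profile \<open>deriv smooth_step\<close>.\<close>

lemma integral_times_deriv_plateau:
  fixes h :: "real \<Rightarrow> real"
  assumes h: "continuous_on UNIV h" and n: "n > 0"
  shows "(LINT t|lebesgue. h t * deriv (plateau l r n) t)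
    = (LINT s|lebesgue. deriv smooth_step s * (h (l + s / n) - h (r + (s - 1) / n)))"
proof -
  let ?S = "deriv smooth_step"
  have S: "continuous_on UNIV ?S"
    by (intro smooth_continuous smooth_deriv smooth_smooth_step)
  have int: "integrable lebesgue (\<lambda>t. g t * ?S (a * t + c))"
    if "continuous_on UNIV g" "a > 0" for g :: "real \<Rightarrow> real" and a c
  proof -
    have "integrable lborel (\<lambda>t. g t * ?S (a * t + c))"
    proof (rule integrable_continuous_compact_support[OF compact_Icc[of "- c / a" "(1 - c) / a"]])
      show "continuous_on UNIV (\<lambda>t. g t * ?S (a * t + c))"
        by (intro continuous_intros continuous_on_compose2[OF S] that) auto
      show "t \<in> {- c / a..(1 - c) / a}" if "g t * ?S (a * t + c) \<noteq> 0" for t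
        using deriv_smooth_step[of "a * t + c"] that \<open>a > 0\<close> by (auto simp: field_simps)
    qed
    then show ?thesis by (subst integrable_completion[OF borel_measurable_integrable])
  qed
  have int0: "integrable lebesgue (\<lambda>s. ?S s * g s)" if "continuous_on UNIV g" for g :: "real \<Rightarrow> real"
    using int[OF that, of 1 0] by (simp add: mult.commute)
  have "(LINT t|lebesgue. h t * deriv (plateau l r n) t)
      = (LINT t|lebesgue. n * (h t * ?S (n * t + (- n * l))) - n * (h t * ?S (n * t + (1 - n * r))))"
    by (intro Bochner_Integration.integral_cong) (auto simp: deriv_plateau algebra_simps)
  also have "\<dots> = n * (LINT t|lebesgue. h t * ?S (n * t + (- n * l)))
      - n * (LINT t|lebesgue. h t * ?S (n * t + (1 - n * r)))"
    by (subst Bochner_Integration.integral_diff, (intro integrable_mult_right int h n)+,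
        simp only: integral_mult_right_zero)
  also have "(LINT t|lebesgue. h t * ?S (n * t + (- n * l))) = 1 / n * (LINT s|lebesgue. ?S s * h (l + s / n))"
    using n by (subst lebesgue_integral_real_affine[of "1 / n" _ l]) (simp_all add: algebra_simps)
  also have "(LINT t|lebesgue. h t * ?S (n * t + (1 - n * r))) = 1 / n * (LINT s|lebesgue. ?S s * h (r + (s - 1) / n))"
    using n by (subst lebesgue_integral_real_affine[of "1 / n" _ "r - 1 / n"]) (simp_all add: field_simps)
  also have "n * (1 / n * (LINT s|lebesgue. ?S s * h (l + s / n))) - n * (1 / n * (LINT s|lebesgue. ?S s * h (r + (s - 1) / n)))
     = (LINT s|lebesgue. ?S s * h (l + s / n)) - (LINT s|lebesgue. ?S s * h (r + (s - 1) / n))"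
    using n by simp
  also have "\<dots> = (LINT s|lebesgue. ?S s * h (l + s / n) - ?S s * h (r + (s - 1) / n))"
    using n by (intro Bochner_Integration.integral_diff[symmetric] int0 continuous_on_compose2[OF h] continuous_intros) auto
  finally show ?thesis by (simp add: algebra_simps)
qed

text \<open>The two unit masses move to the ends of the interval, so the limit is \<open>h l - h r\<close>.\<close>

lemma tendsto_integral_times_deriv_plateau:
  fixes h :: "real \<Rightarrow> real"
  assumes h: "continuous_on UNIV h" and bound: "\<And>t. \<bar>h t\<bar> \<le> M" and eq: "h l = h r"
  shows "(\<lambda>n. LINT t|lebesgue. h t * deriv (plateau (l + 1 / real n) (r - 1 / real n) (real n)) t) \<longlonglongrightarrow> 0"
proof -
  let ?S = "deriv smooth_step"
  let ?g = "\<lambda>n s. h (l + 1 / real n + s / real n) - h (r - 1 / real n + (s - 1) / real n)"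
  have S: "continuous_on UNIV ?S"
    by (intro smooth_continuous smooth_deriv smooth_smooth_step)
  have iS: "integrable lborel ?S"
  proof (rule integrable_continuous_compact_support[OF compact_Icc S])
    show "t \<in> {0..1}" if "?S t \<noteq> 0" for t
      using deriv_smooth_step[OF that] by simp
  qed
  have hb: "h \<in> borel_measurable borel" by (rule borel_measurable_continuous_onI[OF h])
  have "(\<lambda>n. LINT s|lborel. ?S s * ?g n s) \<longlonglongrightarrow> (LINT s|(lborel::real measure). 0)"
  proof (rule integral_dominated_convergence[where w = "\<lambda>s. \<bar>?S s\<bar> * (2 * M)"])
    show "(\<lambda>s. ?S s * ?g n s) \<in> borel_measurable lborel" for n
      using iS hb by (intro borel_measurable_times borel_measurable_diff measurable_compose[OF _ hb]) auto
    show "integrable lborel (\<lambda>s. \<bar>?S s\<bar> * (2 * M))" using iS by simp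
    have "(\<lambda>n. ?g n s) \<longlonglongrightarrow> h (l + 0 + 0) - h (r - 0 + 0)" for s
      by (intro tendsto_diff continuous_on_tendsto_compose[OF h] tendsto_add tendsto_const lim_1_over_n
          lim_const_over_n) auto
    then have "(\<lambda>n. ?S s * ?g n s) \<longlonglongrightarrow> ?S s * (h l - h r)" for s
      using tendsto_mult_left by fastforce
    then show "AE s in lborel. (\<lambda>n. ?S s * ?g n s) \<longlonglongrightarrow> 0" by (simp add: eq)
    have "\<bar>?g n s\<bar> \<le> 2 * M" for n s
      using bound[of "l + 1 / real n + s / real n"] bound[of "r - 1 / real n + (s - 1) / real n"] by linarith
    then show "AE s in lborel. norm (?S s * ?g n s) \<le> \<bar>?S s\<bar> * (2 * M)" for n
      by (intro AE_I2) (simp add: abs_mult mult_left_mono)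
  qed simp
  moreover have "eventually (\<lambda>n. (LINT s|lborel. ?S s * ?g n s)
      = (LINT t|lebesgue. h t * deriv (plateau (l + 1 / real n) (r - 1 / real n) (real n)) t)) sequentially"
    using eventually_gt_at_top[of 0]
  proof eventually_elim
    case (elim n)
    have "(\<lambda>s. ?S s * ?g n s) \<in> borel_measurable lborel"
      using iS hb by (intro borel_measurable_times borel_measurable_diff measurable_compose[OF _ hb]) auto
    then show ?case using elim by (simp add: integral_times_deriv_plateau[OF h] integral_completion)
  qed
  ultimately show ?thesis by (simp add: tendsto_cong)
qed

lemma tendsto_shrinking_plateau:
  assumes "l < t" "t < r"
  shows "(\<lambda>n. plateau (l + 1 / real n) (r - 1 / real n) (real n) t) \<longlonglongrightarrow> 1"
proof -
  have "filterlim (\<lambda>n. real n * (t - l)) at_top sequentially"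
    "filterlim (\<lambda>n. real n * (r - t)) at_top sequentially"
    using assms by (auto intro!: filterlim_at_top_mult_tendsto_pos[OF tendsto_const] filterlim_real_sequentially)
  then have "eventually (\<lambda>n. real n * (t - l) \<ge> 2) sequentially"
      "eventually (\<lambda>n. real n * (r - t) \<ge> 2) sequentially"
    by (auto simp: filterlim_at_top)
  then have "eventually (\<lambda>n. plateau (l + 1 / real n) (r - 1 / real n) (real n) t = 1) sequentially"
    using eventually_gt_at_top[of 0]
  proof eventually_elim
    case (elim n)
    then have "real n * (t - (l + 1 / real n)) = real n * (t - l) - 1"
      "real n * (t - (r - 1 / real n)) + 1 = 2 - real n * (r - t)"
      by (simp_all add: field_simps)
    then show ?case using elim by (simp add: plateau_def smooth_step_eq_1 smooth_step_eq_0)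
  qed
  then show ?thesis by (rule tendsto_eventually)
qed

text \<open>Testing \<open>v\<close> with products of plateau functions which tend to one on the whole box, the integrals
  tend to the integral of \<open>v\<close> by dominated convergence. By the definition of weak derivatives and by
  separation of variables they are also bounded by a constant times a one-dimensional integral
  which tends to \<open>f (l \<bullet> k) - f (r \<bullet> k) = 0\<close>. Periodicity enters the theorem here.\<close>

lemma integral_weak_partial_deriv_eq_0:
  fixes l r :: "'a::euclidean_space"
  assumes k: "k \<in> Basis" and lr: "\<And>b. b \<in> Basis \<Longrightarrow> l \<bullet> b < r \<bullet> b"
    and f: "continuous_on {l \<bullet> k..r \<bullet> k} f" "f (l \<bullet> k) = f (r \<bullet> k)"
    and w: "weak_partial_deriv (box l r) k (\<lambda>x. f (x \<bullet> k)) v"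
    and v: "v absolutely_integrable_on box l r"
  shows "(LINT x:box l r|lebesgue. v x) = 0"
proof -
  \<comment> \<open>\<open>f\<close> is extended by its boundary values to a bounded continuous function on the line.\<close>
  define h where "h t = f (max (l \<bullet> k) (min (r \<bullet> k) t))" for t
  have clamp: "max (l \<bullet> k) (min (r \<bullet> k) t) \<in> {l \<bullet> k..r \<bullet> k}" for t
    using lr[OF k] by auto
  have h: "continuous_on UNIV h"
    unfolding h_def by (intro continuous_on_compose2[OF f(1)] continuous_intros) (use clamp in blast)
  obtain M where "\<forall>t\<in>{l \<bullet> k..r \<bullet> k}. \<bar>f t\<bar> \<le> M"
    using compact_imp_bounded[OF compact_continuous_image[OF f(1) compact_Icc]] by (auto simp: bounded_iff)
  then have hM: "\<bar>h t\<bar> \<le> M" for t unfolding h_def using clamp by blast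
  have hlr: "h (l \<bullet> k) = h (r \<bullet> k)" using lr[OF k] f(2) by (simp add: h_def)
  define \<alpha> where "\<alpha> n b = plateau (l \<bullet> b + 1 / real n) (r \<bullet> b - 1 / real n) (real n)" for n b
  let ?\<psi> = "\<lambda>n. tensor (\<alpha> n)"
  let ?w = "\<lambda>x. indicator (box l r) x * v x"
  let ?C = "\<Prod>b\<in>Basis - {k}. r \<bullet> b - l \<bullet> b"
  have wi: "integrable lebesgue ?w" using v by (simp add: set_integrable_def)
  have sm: "smooth (\<alpha> n b)" for n b by (simp add: \<alpha>_def smooth_plateau)
  have "(\<lambda>n. LINT x|lebesgue. ?w x * ?\<psi> n x) \<longlonglongrightarrow> (LINT x|lebesgue. ?w x)"
  proof (rule integral_dominated_convergence[where w = "\<lambda>x. \<bar>?w x\<bar>"])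
    have "(\<lambda>n. ?\<psi> n x) \<longlonglongrightarrow> (\<Prod>b\<in>(Basis::'a set). 1)" if "x \<in> box l r" for x
      unfolding tensor_def \<alpha>_def using that
      by (intro tendsto_prod tendsto_shrinking_plateau) (auto simp: mem_box)
    then have "(\<lambda>n. ?w x * ?\<psi> n x) \<longlonglongrightarrow> ?w x" for x
      using tendsto_mult_left[of "\<lambda>n. ?\<psi> n x" 1 sequentially "?w x"] by (cases "x \<in> box l r") auto
    then show "AE x in lebesgue. (\<lambda>n. ?w x * ?\<psi> n x) \<longlonglongrightarrow> ?w x" by simp
    have "\<bar>?\<psi> n x\<bar> \<le> 1" for n x
      unfolding tensor_def abs_prod \<alpha>_def by (intro prod_le_1) (simp add: abs_plateau_le_1)
    then show "AE x in lebesgue. norm (?w x * ?\<psi> n x) \<le> \<bar>?w x\<bar>" for n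
      by (intro AE_I2) (auto simp: abs_mult intro: mult_left_le)
    have "?\<psi> n \<in> borel_measurable borel" for n
      by (intro borel_measurable_continuous_onI smooth_continuous smooth_tensor sm)
    then have "?\<psi> n \<in> borel_measurable lebesgue" for n by (simp add: measurable_completion)
    then show "(\<lambda>x. ?w x * ?\<psi> n x) \<in> borel_measurable lebesgue" for n
      by (intro borel_measurable_times[OF borel_measurable_integrable[OF wi]])
  qed (use wi in auto)
  moreover have "(\<lambda>n. LINT x|lebesgue. ?w x * ?\<psi> n x) \<longlonglongrightarrow> 0"
  proof (rule Lim_null_comparison)
    show "(\<lambda>n. \<bar>LINT t|lebesgue. h t * deriv (\<alpha> n k) t\<bar> * ?C) \<longlonglongrightarrow> 0"
      unfolding \<alpha>_def
      by (intro tendsto_mult_left_zero tendsto_rabs_zero tendsto_integral_times_deriv_plateau[OF h hM hlr])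
    \<comment> \<open>Two of the three units are lost to the margins \<open>1 / n\<close>; the last one separates ascent and descent.\<close>
    have "eventually (\<lambda>n. \<forall>b\<in>Basis. 3 \<le> real n * (r \<bullet> b - l \<bullet> b)) sequentially"
    proof (intro eventually_ball_finite ballI finite_Basis)
      fix b :: 'a
      assume "b \<in> Basis"
      then have "filterlim (\<lambda>n. real n * (r \<bullet> b - l \<bullet> b)) at_top sequentially"
        using lr by (intro filterlim_at_top_mult_tendsto_pos[OF tendsto_const] filterlim_real_sequentially) auto
      then show "eventually (\<lambda>n. 3 \<le> real n * (r \<bullet> b - l \<bullet> b)) sequentially"
        by (auto simp: filterlim_at_top)
    qed
    then show "eventually (\<lambda>n. norm (LINT x|lebesgue. ?w x * ?\<psi> n x)
        \<le> \<bar>LINT t|lebesgue. h t * deriv (\<alpha> n k) t\<bar> * ?C) sequentially"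
      using eventually_gt_at_top[of 0]
    proof eventually_elim
      case (elim n)
      then have n: "real n > 0" by simp
      define p q where "p = l + (1 / real n) *\<^sub>R One" and "q = r - (1 / real n) *\<^sub>R One"
      have pq: "p \<bullet> b = l \<bullet> b + 1 / real n" "q \<bullet> b = r \<bullet> b - 1 / real n" if "b \<in> Basis" for b
        using that by (simp_all add: p_def q_def inner_add_left inner_diff_left)
      have sub: "cbox p q \<subseteq> box l r"
      proof
        fix x
        assume x: "x \<in> cbox p q"
        have "l \<bullet> b < x \<bullet> b \<and> x \<bullet> b < r \<bullet> b" if b: "b \<in> Basis" for b
        proof -
          have "1 / real n > 0" using n by simp
          moreover have "p \<bullet> b \<le> x \<bullet> b" "x \<bullet> b \<le> q \<bullet> b" using x b by (simp_all add: mem_box)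
          ultimately show ?thesis unfolding pq[OF b] by linarith
        qed
        then show "x \<in> box l r" by (simp add: mem_box)
      qed
      have big: "1 \<le> real n * ((r \<bullet> b - 1 / real n) - (l \<bullet> b + 1 / real n))" if "b \<in> Basis" for b
      proof -
        have "real n * ((r \<bullet> b - 1 / real n) - (l \<bullet> b + 1 / real n)) = real n * (r \<bullet> b - l \<bullet> b) - 2"
          using n by (simp add: right_diff_distrib distrib_left)
        then show ?thesis using bspec[OF elim(1) that] by simp
      qed
      have supp: "\<alpha> n b t = 0" "deriv (\<alpha> n b) t = 0" 
        if "b \<in> Basis" "t \<notin> {l \<bullet> b + 1 / real n<..<r \<bullet> b - 1 / real n}" for b t
        using plateau_eq_0[OF n big[OF that(1)] that(2)] deriv_plateau_eq_0[OF n big[OF that(1)] that(2)]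
        by (auto simp: \<alpha>_def)
      have t: "?\<psi> n \<in> test_functions (box l r)"
      proof (rule tensor_in_test_functions[OF sm sub])
        show "p \<bullet> b \<le> t \<and> t \<le> q \<bullet> b" if "b \<in> Basis" "\<alpha> n b t \<noteq> 0" for b t
          using supp(1)[of b t] that by (fastforce simp: pq)
      qed
      define \<alpha>' where "\<alpha>' = (\<alpha> n)(k := deriv (\<alpha> n k))"
      have tsupp: "tensor \<alpha>' x = 0" if x: "x \<notin> box l r" for x
      proof -
        from x have "x \<notin> cbox p q" using sub by blast
        then obtain b where "b \<in> Basis" "x \<bullet> b \<notin> {p \<bullet> b..q \<bullet> b}" by (auto simp: mem_box)
        then show "tensor \<alpha>' x = 0"
          using supp[of b "x \<bullet> b"] by (auto simp: tensor_def \<alpha>'_def pq)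
      qed
      have int: "integrable lebesgue (\<alpha> n b)" "integrable lebesgue (\<alpha>' b)" if "b \<in> Basis" for b
        using integrable_lebesgue_plateau[OF n big[OF that]] by (auto simp: \<alpha>_def \<alpha>'_def)
      have hI: "indicator {l \<bullet> k<..<r \<bullet> k} t *\<^sub>R (f t * deriv (\<alpha> n k) t) = h t * deriv (\<alpha> n k) t" for t
      proof (cases "t \<in> {l \<bullet> k<..<r \<bullet> k}")
        case False
        moreover have "1 / real n > 0" using n by simp
        ultimately have "t \<notin> {l \<bullet> k + 1 / real n<..<r \<bullet> k - 1 / real n}"
          unfolding greaterThanLessThan_iff by linarith
        then have "deriv (\<alpha> n k) t = 0" by (rule supp(2)[OF k])
        then show ?thesis by simp
      qed (simp add: h_def)
      have "continuous_on UNIV (\<lambda>t. h t * deriv (\<alpha> n k) t)"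
        by (intro continuous_intros h smooth_continuous smooth_deriv sm)
      then have "integrable lborel (\<lambda>t. h t * deriv (\<alpha> n k) t)"
        by (rule integrable_continuous_compact_support[OF compact_Icc[of "l \<bullet> k" "r \<bullet> k"]])
           (metis hI indicator_simps(2) scaleR_zero_left greaterThanLessThan_iff atLeastAtMost_iff less_imp_le)
      then have "integrable lebesgue (\<lambda>t. h t * deriv (\<alpha> n k) t)"
        by (subst integrable_completion[OF borel_measurable_integrable])
      then have ik: "set_integrable lebesgue {l \<bullet> k<..<r \<bullet> k} (\<lambda>t. f t * \<alpha>' k t)"
        by (simp add: set_integrable_def \<alpha>'_def hI del: real_scaleR_def)
      have le: "\<bar>LINT t|lebesgue. \<alpha> n b t\<bar> \<le> r \<bullet> b - l \<bullet> b" if b: "b \<in> Basis" for b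
      proof -
        have "\<bar>LINT t|lebesgue. \<alpha> n b t\<bar> \<le> (LINT t|lebesgue. \<bar>\<alpha> n b t\<bar>)"
          by (rule integral_abs_bound)
        also have "\<dots> \<le> (LINT t|lebesgue. indicator {l \<bullet> b..r \<bullet> b} t)"
        proof (rule integral_mono)
          show "\<bar>\<alpha> n b t\<bar> \<le> indicator {l \<bullet> b..r \<bullet> b} t" for t
          proof (cases "t \<in> {l \<bullet> b..r \<bullet> b}")
            case True
            then show ?thesis using abs_plateau_le_1 by (simp add: \<alpha>_def)
          next
            case False
            moreover have "1 / real n > 0" using n by simp
            ultimately have "t \<notin> {l \<bullet> b + 1 / real n<..<r \<bullet> b - 1 / real n}"
              unfolding greaterThanLessThan_iff atLeastAtMost_iff by linarith
            then have "\<alpha> n b t = 0" by (rule supp(1)[OF b])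
            then show ?thesis by simp
          qed
          show "integrable lebesgue (indicat_real {l \<bullet> b..r \<bullet> b})"
            by (intro integrable_real_indicator) (auto simp: emeasure_lborel_Icc_eq)
        qed (use int(1)[OF b] in auto)
        also have "\<dots> = r \<bullet> b - l \<bullet> b" using lr[OF b] by simp
        finally show ?thesis .
      qed
      have "(LINT x|lebesgue. ?w x * ?\<psi> n x) = (LINT x:box l r|lebesgue. v x * ?\<psi> n x)"
        by (simp add: set_lebesgue_integral_def mult.assoc)
      also have "\<dots> = - (LINT x:box l r|lebesgue. f (x \<bullet> k) * frechet_derivative (?\<psi> n) (at x) k)"
        using w t by (simp add: weak_partial_deriv_def)
      also have "(\<lambda>x. f (x \<bullet> k) * frechet_derivative (?\<psi> n) (at x) k) = (\<lambda>x. f (x \<bullet> k) * tensor \<alpha>' x)"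
        unfolding \<alpha>'_def by (simp only: frechet_derivative_tensor[OF sm k])
      also have "(LINT x:box l r|lebesgue. f (x \<bullet> k) * tensor \<alpha>' x)
        = (LINT t:{l \<bullet> k<..<r \<bullet> k}|lebesgue. f t * \<alpha>' k t) * (\<Prod>b\<in>Basis - {k}. LINT t|lebesgue. \<alpha>' b t)"
        by (rule cylinder_integral(2)[OF k tsupp ik int(2)])
      also have "(LINT t:{l \<bullet> k<..<r \<bullet> k}|lebesgue. f t * \<alpha>' k t) = (LINT t|lebesgue. h t * deriv (\<alpha> n k) t)"
        by (simp add: set_lebesgue_integral_def \<alpha>'_def hI del: real_scaleR_def)
      also have "(\<Prod>b\<in>Basis - {k}. LINT t|lebesgue. \<alpha>' b t) = (\<Prod>b\<in>Basis - {k}. LINT t|lebesgue. \<alpha> n b t)"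
        by (intro prod.cong) (auto simp: \<alpha>'_def)
      finally have "\<bar>LINT x|lebesgue. ?w x * ?\<psi> n x\<bar> = \<bar>LINT t|lebesgue. h t * deriv (\<alpha> n k) t\<bar>
          * (\<Prod>b\<in>Basis - {k}. \<bar>LINT t|lebesgue. \<alpha> n b t\<bar>)"
        by (simp add: abs_mult abs_prod)
      also have "\<dots> \<le> \<bar>LINT t|lebesgue. h t * deriv (\<alpha> n k) t\<bar> * ?C"
        by (intro mult_left_mono prod_mono) (use le in auto)
      finally show ?case by simp
    qed
  qed
  ultimately have "(LINT x|lebesgue. ?w x) = 0" by (rule LIMSEQ_unique)
  then show ?thesis by (simp add: set_lebesgue_integral_def)
qed

section \<open>Weak Jacobians\<close>

lemma weak_jacobian_linear: "weak_jacobian U (\<lambda>x. A *v x) (\<lambda>_. A)"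
  unfolding weak_jacobian_def
proof (intro allI)
  fix i j
  have "weak_partial_deriv U (axis j 1) (\<lambda>x. x \<bullet> (A $ i)) (\<lambda>x. axis j 1 \<bullet> (A $ i))"
    by (rule weak_partial_deriv_inner) (simp add: axis_in_Basis_iff)
  then show "weak_partial_deriv U (axis j 1) (\<lambda>x. (A *v x) $ i) (\<lambda>x. A $ i $ j)"
    by (simp add: matrix_vector_mul_component inner_commute[of "A $ i"] inner_axis')
qed

lemma weak_jacobian_add:
  "weak_jacobian U u G \<Longrightarrow> weak_jacobian U v H \<Longrightarrow> weak_jacobian U (\<lambda>x. u x + v x) (\<lambda>x. G x + H x)"
  by (auto simp: weak_jacobian_def axis_in_Basis_iff intro: weak_partial_deriv_add)

lemma weak_jacobian_cong:
  assumes "weak_jacobian U u G" "\<And>x. x \<in> U \<Longrightarrow> u x = v x"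
  shows "weak_jacobian U v G"
  unfolding weak_jacobian_def
proof (intro allI)
  fix i j
  have "weak_partial_deriv U (axis j 1) (\<lambda>x. u x $ i) (\<lambda>x. G x $ i $ j)"
    using assms(1) by (simp add: weak_jacobian_def)
  then show "weak_partial_deriv U (axis j 1) (\<lambda>x. v x $ i) (\<lambda>x. G x $ i $ j)"
    by (rule weak_partial_deriv_cong) (simp_all add: assms(2))
qed

lemma AE_weak_grad_eq:
  assumes "open U" "weak_jacobian U u G"
  shows "AE x in lebesgue. x \<in> U \<longrightarrow> weak_grad U u x = G x"
proof -
  have w: "weak_jacobian U u (weak_grad U u)"
    unfolding weak_grad_def using assms(2) by (rule someI[of "weak_jacobian U u"])
  have "AE x in lebesgue. x \<in> U \<longrightarrow> weak_grad U u x $ i $ j = G x $ i $ j" for i j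
    using w assms(2) weak_partial_deriv_unique[OF assms(1)] unfolding weak_jacobian_def by blast
  then have "AE x in lebesgue. \<forall>i j. x \<in> U \<longrightarrow> weak_grad U u x $ i $ j = G x $ i $ j"
    by (intro eventually_all_finite)
  then show ?thesis by eventually_elim (simp add: vec_eq_iff)
qed

section \<open>The energy density on diagonal matrices\<close>

lemma diag2_nth [simp]:
  "diag2 p q $ 1 $ 1 = p" "diag2 p q $ 1 $ 2 = 0" "diag2 p q $ 2 $ 1 = 0" "diag2 p q $ 2 $ 2 = q"
  by (simp_all add: diag2_def)

text \<open>The matrix \<open>F\<^sup>T F\<close> is diagonal with entries \<open>p\<^sup>2\<close> and \<open>q\<^sup>2\<close>; a nonzero vector has a nonzero
  coordinate, from which the eigenvalue can be read off.\<close>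

lemma singular_values_diag2:
  assumes "p \<ge> 0" "q \<ge> 0"
  shows "singular_values (diag2 p q) = {p, q}"
proof -
  have eig: "(transpose (diag2 p q) ** diag2 p q) *v v = s\<^sup>2 *\<^sub>R v
      \<longleftrightarrow> p\<^sup>2 * v $ 1 = s\<^sup>2 * v $ 1 \<and> q\<^sup>2 * v $ 2 = s\<^sup>2 * v $ 2" for v s
    by (simp add: vec_eq_iff forall_2 matrix_vector_mult_def matrix_matrix_mult_def transpose_def
        sum_2 power2_eq_square)
  have nz: "v \<noteq> 0 \<longleftrightarrow> v $ 1 \<noteq> 0 \<or> v $ 2 \<noteq> 0" for v :: "real^2"
    by (simp add: vec_eq_iff forall_2)
  show ?thesis
  proof (intro set_eqI iffI)
    fix s
    assume "s \<in> singular_values (diag2 p q)"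
    then have "s \<ge> 0" "p\<^sup>2 = s\<^sup>2 \<or> q\<^sup>2 = s\<^sup>2"
      unfolding singular_values_def eig nz by auto
    then show "s \<in> {p, q}" using assms by (auto simp: power2_eq_iff_nonneg)
  next
    fix s
    assume s: "s \<in> {p, q}"
    have "p\<^sup>2 * (axis 1 1 :: real^2) $ 1 = p\<^sup>2 * (axis 1 1 :: real^2) $ 1 \<and>
        q\<^sup>2 * (axis 1 1 :: real^2) $ 2 = p\<^sup>2 * (axis 1 1 :: real^2) $ 2"
      "p\<^sup>2 * (axis 2 1 :: real^2) $ 1 = q\<^sup>2 * (axis 2 1 :: real^2) $ 1 \<and>
        q\<^sup>2 * (axis 2 1 :: real^2) $ 2 = q\<^sup>2 * (axis 2 1 :: real^2) $ 2"
      by (simp_all add: axis_def)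
    moreover have "axis i 1 \<noteq> (0::real^2)" for i by (simp add: axis_eq_0_iff)
    ultimately have "\<exists>v. v \<noteq> 0 \<and> (p\<^sup>2 * v $ 1 = p\<^sup>2 * v $ 1 \<and> q\<^sup>2 * v $ 2 = p\<^sup>2 * (v :: real^2) $ 2)"
      "\<exists>v. v \<noteq> 0 \<and> (p\<^sup>2 * v $ 1 = q\<^sup>2 * v $ 1 \<and> q\<^sup>2 * v $ 2 = q\<^sup>2 * (v :: real^2) $ 2)"
      by blast+
    then show "s \<in> singular_values (diag2 p q)"
      unfolding singular_values_def eig using s assms by auto
  qed
qed

text \<open>For a fixed smaller singular value the energy density is affine in the larger one. The
  ordering \<open>p \<ge> q\<close> decides which of the two entries is the larger singular value.\<close>

lemma W_magic_diag2:
  assumes "p \<ge> q" "q > 0"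
  shows "W_magic (diag2 p q) = p / q + 2 * ln q"
  using assms by (simp add: W_magic_def lambda_max_def lambda_min_def singular_values_diag2)

lemma diag2_in_GLpos2: "p > 0 \<Longrightarrow> q > 0 \<Longrightarrow> diag2 p q \<in> GLpos2"
  by (simp add: GLpos2_def det_2)

section \<open>The energy of a periodic deformation\<close>

lemma interior_unit_square: "interior unit_square = box 0 1"
  by (simp add: unit_square_def)

lemma AE_unit_square_imp_interior: "AE x in lebesgue. x \<in> unit_square \<longrightarrow> x \<in> box 0 1"
proof -
  have "AE x in lebesgue. x \<notin> cbox 0 1 - (box 0 1 :: (real^2) set)"
    using negligible_frontier_interval by (intro AE_not_in) (simp add: negligible_iff_null_sets)
  then show ?thesis by (auto simp: unit_square_def)
qed

text \<open>The energy is defined through a chosen weak gradient on the open square and an integral over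
  the closed square. Neither choice matters: weak gradients agree almost everywhere, and the boundary
  of the square is a null set. The measurability of the integrand comes from \<open>g\<close>.\<close>

lemma energy_of_weak_jacobian:
  assumes G: "weak_jacobian (box 0 1) \<phi> G"
    and pos: "AE x in lebesgue. x \<in> box 0 1 \<longrightarrow> G x \<in> GLpos2"
    and W: "AE x in lebesgue. x \<in> box 0 1 \<longrightarrow> W_magic (G x) = g x"
    and g: "g absolutely_integrable_on box 0 1"
  shows "energy_well_defined \<phi>" and "energy \<phi> = (LINT x:box 0 1|lebesgue. g x)"
proof -
  let ?W = "\<lambda>x. W_magic (weak_grad (box 0 1) \<phi> x)"
  have grad: "AE x in lebesgue. x \<in> unit_square \<longrightarrow>
      x \<in> box 0 1 \<and> weak_grad (box 0 1) \<phi> x = G x \<and> G x \<in> GLpos2 \<and> W_magic (G x) = g x"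
    using AE_weak_grad_eq[OF open_box G] AE_unit_square_imp_interior pos W
    by eventually_elim auto
  have sub: "box 0 1 \<subseteq> unit_square" by (simp add: unit_square_def box_subset_cbox)
  have ae: "AE x in lebesgue. indicator (box 0 1) x *\<^sub>R g x = indicator unit_square x *\<^sub>R ?W x"
    using grad
  proof eventually_elim
    case (elim x)
    then show ?case using sub by (cases "x \<in> unit_square") (auto simp: indicator_def)
  qed
  have gi: "integrable lebesgue (\<lambda>x. indicator (box 0 1) x *\<^sub>R g x)"
    using g by (simp add: set_integrable_def)
  have Wm: "(\<lambda>x. indicator unit_square x *\<^sub>R ?W x) \<in> borel_measurable lebesgue"
    by (rule borel_measurable_AE[OF borel_measurable_integrable[OF gi] ae])
  have "?W absolutely_integrable_on unit_square"
    unfolding set_integrable_def by (rule integrable_cong_AE_imp[OF gi Wm]) (use ae in \<open>eventually_elim, simp\<close>)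
  moreover have "AE x in lebesgue_on unit_square. weak_grad (box 0 1) \<phi> x \<in> GLpos2"
  proof -
    have "unit_square \<in> sets lebesgue" by (simp add: unit_square_def)
    moreover have "AE x in lebesgue. x \<in> unit_square \<longrightarrow> weak_grad (box 0 1) \<phi> x \<in> GLpos2"
      using grad by eventually_elim auto
    ultimately show ?thesis by (subst AE_restrict_space_iff) auto
  qed
  ultimately show "energy_well_defined \<phi>"
    using G by (auto simp: energy_well_defined_def interior_unit_square)
  show "energy \<phi> = (LINT x:box 0 1|lebesgue. g x)"
    unfolding energy_def set_lebesgue_integral_def interior_unit_square
    by (rule integral_cong_AE[OF Wm borel_measurable_integrable[OF gi]]) (use ae in \<open>eventually_elim, simp\<close>)
qed

lemma L_infinity_component_absolutely_integrable:
  fixes G :: "real^2 \<Rightarrow> real^2^2"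
  assumes "L_infinity (box 0 1) G"
  shows "(\<lambda>x. G x $ i $ j) absolutely_integrable_on box 0 1"
proof -
  obtain C where m: "G \<in> borel_measurable (lebesgue_on (box 0 1))"
      and C: "AE x in lebesgue_on (box 0 1). norm (G x) \<le> C"
    using assms by (auto simp: L_infinity_def)
  have "finite_measure (lebesgue_on (box 0 1 :: (real^2) set))"
    by (rule finite_measure_lebesgue_on) simp
  moreover have "AE x in lebesgue_on (box 0 1). norm (G x $ i $ j) \<le> C"
    using C by eventually_elim (rule order_trans[OF order_trans[OF Finite_Cartesian_Product.norm_nth_le Finite_Cartesian_Product.norm_nth_le]])
  moreover have "(\<lambda>x. G x $ i $ j) \<in> borel_measurable (lebesgue_on (box 0 1))"
  proof -
    have "(\<lambda>A::real^2^2. A $ i $ j) \<in> borel_measurable borel"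
      by (intro borel_measurable_continuous_onI continuous_on_component continuous_on_id)
    from measurable_compose[OF m this] show ?thesis .
  qed
  ultimately have "integrable (lebesgue_on (box 0 1)) (\<lambda>x. G x $ i $ j)"
    by (rule finite_measure.integrable_const_bound)
  moreover have "box 0 1 \<inter> space lebesgue \<in> sets (lebesgue :: (real^2) measure)" by simp
  ultimately show ?thesis
    unfolding set_integrable_def by (simp only: integrable_restrict_space)
qed

theorem lemma4p1:
  fixes a\<^sub>1 a\<^sub>2 :: real and f f' :: "real \<Rightarrow> real" and \<theta> \<phi> :: "real^2 \<Rightarrow> real^2"
  assumes "a\<^sub>1 \<ge> a\<^sub>2" and "a\<^sub>2 > 0"
    and "periodic_deformation (diag2 a\<^sub>1 a\<^sub>2) \<theta> \<phi>"
    and "\<forall>x\<in>unit_square. \<theta> x = vector [f (x $ 1), 0]"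
    and "derivative_function {0..1} f f'"
    and "f' 0 = f' 1"
    and "\<forall>x\<in>{0..1}. f' x \<ge> a\<^sub>2 - a\<^sub>1"
  shows "energy_well_defined \<phi> \<and> energy \<phi> = energy (\<lambda>x. diag2 a\<^sub>1 a\<^sub>2 *v x)"
proof -
  let ?F = "diag2 a\<^sub>1 a\<^sub>2"
  let ?U = "box 0 1 :: (real^2) set"
  let ?e = "axis 1 1 :: real^2"
  have sub: "?U \<subseteq> unit_square" by (simp add: unit_square_def box_subset_cbox)
  have \<theta>: "\<theta> x $ 1 = f (x \<bullet> ?e)" "\<theta> x $ 2 = 0" if "x \<in> unit_square" for x
    using assms(4) that by (auto simp: inner_axis)
  obtain G where G: "weak_jacobian ?U \<theta> G" "L_infinity ?U G"
    using assms(3) by (auto simp: periodic_deformation_def periodic_superposition_def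
        W1_infinity_def interior_unit_square)
  have basis: "axis j 1 \<in> (Basis :: (real^2) set)" for j by (simp add: axis_in_Basis_iff)
  have corner: "0 \<bullet> ?e = 0" "1 \<bullet> ?e = 1" by (simp_all add: inner_axis)

  have f': "weak_partial_deriv {0 \<bullet> ?e<..<1 \<bullet> ?e} 1 f f'"
    using assms(5) by (simp add: derivative_function_def corner interior_atLeastAtMost_real)
  have G1: "weak_partial_deriv ?U (axis j 1) (\<lambda>x. f (x \<bullet> ?e)) (\<lambda>x. G x $ 1 $ j)" for j
    by (rule weak_partial_deriv_cong[of _ _ "\<lambda>x. \<theta> x $ 1"])
       (use G(1) \<theta> sub in \<open>auto simp: weak_jacobian_def\<close>)
  \<comment> \<open>The zero function is written as an inner product with \<open>0\<close> to have its weak derivative at hand.\<close>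
  have G2: "weak_partial_deriv ?U (axis j 1) (\<lambda>x. x \<bullet> 0) (\<lambda>x. G x $ 2 $ j)" for j
    by (rule weak_partial_deriv_cong[of _ _ "\<lambda>x. \<theta> x $ 2"])
       (use G(1) \<theta> sub in \<open>auto simp: weak_jacobian_def\<close>)
  have ae1: "AE x in lebesgue. x \<in> ?U \<longrightarrow> G x $ 1 $ j = (if axis j 1 = ?e then f' (x \<bullet> ?e) else 0)" for j
    by (rule weak_partial_deriv_cylinder[OF basis basis f' G1])
  have ae2: "AE x in lebesgue. x \<in> ?U \<longrightarrow> G x $ 2 $ j = 0" for j
    using weak_partial_deriv_unique[OF open_box G2 weak_partial_deriv_inner[OF basis]] by simp
  have Gx: "AE x in lebesgue. x \<in> ?U \<longrightarrow>
      ?F + G x = diag2 (a\<^sub>1 + G x $ 1 $ 1) a\<^sub>2 \<and> a\<^sub>2 \<le> a\<^sub>1 + G x $ 1 $ 1"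
    using ae1[of 1] ae1[of 2] ae2[of 1] ae2[of 2]
  proof eventually_elim
    case (elim x)
    show ?case
    proof
      assume x: "x \<in> ?U"
      then have "x \<bullet> ?e \<in> {0..1}" by (auto simp: mem_box_cart inner_axis less_imp_le)
      then have "f' (x \<bullet> ?e) \<ge> a\<^sub>2 - a\<^sub>1" using assms(7) by blast
      then have G_entries: "G x $ 1 $ 1 \<ge> a\<^sub>2 - a\<^sub>1" "G x $ 1 $ 2 = 0" "G x $ 2 $ 1 = 0" "G x $ 2 $ 2 = 0"
        using elim x by (simp_all add: axis_eq_axis)
      show "?F + G x = diag2 (a\<^sub>1 + G x $ 1 $ 1) a\<^sub>2 \<and> a\<^sub>2 \<le> a\<^sub>1 + G x $ 1 $ 1"
        using G_entries by (simp add: vec_eq_iff forall_2)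
    qed
  qed

  have Gint: "(\<lambda>x. G x $ 1 $ 1) absolutely_integrable_on ?U"
    by (rule L_infinity_component_absolutely_integrable[OF G(2)])
  \<comment> \<open>Periodicity at the corner \<open>(0, 0)\<close> gives \<open>f 0 = f 1\<close>, and \<open>f\<close> is continuous as the first component of \<open>\<theta>\<close> along the bottom edge.\<close>
  have mean: "(LINT x:?U|lebesgue. G x $ 1 $ 1) = 0"
  proof (rule integral_weak_partial_deriv_eq_0[OF basis _ _ _ G1 Gint])
    show "0 \<bullet> b < 1 \<bullet> b" if "b \<in> Basis" for b :: "real^2"
      using that by (auto simp: Basis_vec_def inner_axis)
    have f_eq: "f t = \<theta> (t *\<^sub>R ?e) $ 1" and in_sq: "t *\<^sub>R ?e \<in> unit_square" if "t \<in> {0..1}" for t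
    proof -
      show "t *\<^sub>R ?e \<in> unit_square"
        using that by (auto simp: unit_square_def mem_box_cart forall_2 axis_def)
      then show "f t = \<theta> (t *\<^sub>R ?e) $ 1" by (simp add: \<theta> inner_axis)
    qed
    have cont: "continuous_on unit_square \<theta>" and per: "periodic_on_square \<theta>"
      using assms(3) by (auto simp: periodic_deformation_def periodic_superposition_def)
    have "continuous_on {0..1} (\<lambda>t. \<theta> (t *\<^sub>R ?e) $ 1)"
    proof (rule continuous_on_component[OF continuous_on_compose2[OF cont]])
      show "continuous_on {0..1} (\<lambda>t::real. t *\<^sub>R ?e)" by (intro continuous_intros)
      show "(\<lambda>t. t *\<^sub>R ?e) ` {0..1} \<subseteq> unit_square" using in_sq by blast
    qed
    then show "continuous_on {0 \<bullet> ?e..1 \<bullet> ?e} f"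
      unfolding corner by (rule continuous_on_eq) (simp add: f_eq)
    have "vector [t, 0] = t *\<^sub>R ?e" for t :: real
      by (simp add: vec_eq_iff forall_2 axis_def)
    moreover have "\<theta> (vector [0, 0]) = \<theta> (vector [1, 0])"
      using per unfolding periodic_on_square_def by (elim conjE) (rule bspec, assumption, simp)
    ultimately show "f (0 \<bullet> ?e) = f (1 \<bullet> ?e)"
      using f_eq[of 0] f_eq[of 1] by (simp add: corner)
  qed

  have wF: "weak_jacobian ?U (\<lambda>x. ?F *v x) (\<lambda>_. ?F)" by (rule weak_jacobian_linear)
  have w\<phi>: "weak_jacobian ?U \<phi> (\<lambda>x. ?F + G x)"
    by (rule weak_jacobian_cong[OF weak_jacobian_add[OF wF G(1)]])
       (use assms(3) sub in \<open>auto simp: periodic_deformation_def\<close>)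
  let ?c = "\<lambda>x::real^2. a\<^sub>1 / a\<^sub>2 + 2 * ln a\<^sub>2"
  let ?g = "\<lambda>x. G x $ 1 $ 1 / a\<^sub>2"
  have ic: "?c absolutely_integrable_on ?U"
    by (rule absolutely_integrable_on_const) simp
  have ig: "?g absolutely_integrable_on ?U" using Gint by simp
  have pos: "AE x in lebesgue. x \<in> ?U \<longrightarrow> ?F + G x \<in> GLpos2"
    using Gx by eventually_elim (use assms(2) in \<open>auto intro!: diag2_in_GLpos2\<close>)
  have W: "AE x in lebesgue. x \<in> ?U \<longrightarrow> W_magic (?F + G x) = ?c x + ?g x"
    using Gx by eventually_elim (use assms(2) in \<open>auto simp: W_magic_diag2 add_divide_distrib\<close>)
  note \<phi> = energy_of_weak_jacobian[OF w\<phi> pos W set_integral_add(1)[OF ic ig]]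
  have "energy \<phi> = (LINT x:?U|lebesgue. ?c x) + (LINT x:?U|lebesgue. ?g x)"
    unfolding \<phi>(2) by (rule set_integral_add(2)[OF ic ig])
  also have "(LINT x:?U|lebesgue. ?g x) = 0" using mean by simp
  also have "(LINT x:?U|lebesgue. ?c x) + 0 = energy (\<lambda>x. ?F *v x)"
    using energy_of_weak_jacobian(2)[OF wF _ _ ic] assms(1,2)
    by (simp add: diag2_in_GLpos2 W_magic_diag2)
  finally show ?thesis using \<phi>(1) by simp
qed

end
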